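(* Let $F=A\circ G$ be a gliders with annihilation on $S^{\mathbb{Z}^d}$, $S=\{0,1\}^N$, and let $\theta$ be a positive birth-death noise on $S$. Then the noisy version of $F$ with noise $\theta$ is uniformly ergodic, with a spatially mixing invariant measure.
   Context: Let $d\ge1$, $N\ge1$, $S=\{0,1\}^N$, $\mathcal{X}=S^{\mathbb{Z}^d}$ with the product topology; $x_{k,i}$ denotes the $i$th component of the symbol $x_k$ ($x_{k,i}=1$ means a particle of type $i$ is present at site $k$). For finite $K\subseteq\mathbb{Z}^d$ and $y_K\in S^K$, the cylinder $[y_K]$ is $\{x\in\mathcal{X}: x_k=y_k\ \forall k\in K\}$. The shift is $(\sigma^k x)_i=x_{k+i}$. A gliders CA with velocities $v_1,\dots,v_N\in\mathbb{Z}^d$ is the map $G:\mathcal{X}\to\mathcal{X}$, $(Gx)_{k,i}=x_{k+v_i,i}$. Let $\mathbf{e}_i\in S$ have $i$th component $1$ and all others $0$. For $i\ne j$, the elementary annihilation rule $h_{i,j}:S\to S$ is $h_{i,j}(a)=a-\mathbf{e}_i-\mathbf{e}_j$ if $a_i=a_j=1$ and $h_{i,j}(a)=a$ otherwise. An annihilation rule is a finite composition $h=h_{i_n,j_n}\circ\cdots\circ h_{i_1,j_1}$ of elementary ones, and an annihilation CA is $A:\mathcal{X}\to\mathcal{X}$, $(Ax)_k=h(x_k)$, for an annihilation rule $h$. A gliders with annihilation is $F=A\circ G$ with $G$ a gliders CA and $A$ an annihilation CA. A birth-death noise on $S$ is a stochastic matrix $\theta(a,b)=\prod_{i=1}^N\theta_i(a_i,b_i)$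 with $\theta_i=\begin{pmatrix}1-\beta_i&\beta_i\\ \delta_i&1-\delta_i\end{pmatrix}$ (rows and columns indexed by $0,1$), $\beta_i,\delta_i\in[0,1]$; it is positive if $\beta_i,\delta_i\in(0,1)$ for all $i$. The noisy version of $F$ with noise $\theta$ is the Markov kernel $\Phi$ on $\mathcal{X}$ given by $\Phi(x,[y_K])=\prod_{k\in K}\theta\big((Fx)_k,y_k\big)$ for every cylinder $[y_K]$. A Borel probability measure $\pi$ is invariant if $\pi\Phi=\pi$. $\Phi$ is uniformly ergodic if it has a unique invariant measure $\pi$ and $\Phi^t(x,[u])\to\pi([u])$ as $t\to\infty$, uniformly in $x\in\mathcal{X}$, for each cylinder $[u]$. $\pi$ is spatially mixing if $\lim_{k\to\infty}\pi([u]\cap\sigma^{-k}[v])=\pi([u])\pi([v])$ for all cylinders $[u],[v]$. *)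

theory Defs
  imports "HOL-Probability.Probability"
begin

section \<open>Configurations\<close>

text \<open>
  The dimension \<open>d \<ge> 1\<close> and the number of particle types \<open>N \<ge> 1\<close> are the cardinalities of the
  index types \<open>'d\<close> and \<open>'n\<close>. A symbol in \<open>{0,1}\<^sup>N\<close> is a Boolean function on \<open>'n\<close>, with
  \<open>True\<close> standing for \<open>1\<close>, so \<open>x k i\<close> says that \<open>x\<close> has a particle of type \<open>i\<close> at site \<open>k\<close>.
  The topology on configurations is the product topology on functions, with \<open>bool\<close> discrete,
  and \<open>borel\<close> below is the Borel sigma-algebra of that topology.
\<close>

type_synonym 'd site = "int ^ 'd"
type_synonym 'n symbol = "'n \<Rightarrow> bool"
type_synonym ('d, 'n) config = "'d site \<Rightarrow> 'n symbol"

text \<open>Only the restriction of \<open>y\<close> to \<open>K\<close> matters; \<open>K\<close> is finite wherever this is used.\<close>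

definition cylinder :: "'d::finite site set \<Rightarrow> ('d, 'n) config \<Rightarrow> ('d, 'n) config set" where
  "cylinder K y = {x. \<forall>k\<in>K. x k = y k}"

definition shift :: "'d::finite site \<Rightarrow> ('d, 'n) config \<Rightarrow> ('d, 'n) config" where
  "shift k x = (\<lambda>i. x (k + i))"


section \<open>Gliders with annihilation\<close>

definition gliders :: "('n \<Rightarrow> 'd::finite site) \<Rightarrow> ('d, 'n) config \<Rightarrow> ('d, 'n) config" where
  "gliders v x = (\<lambda>k i. x (k + v i) i)"

definition elem_annihilation :: "'n \<Rightarrow> 'n \<Rightarrow> 'n symbol \<Rightarrow> 'n symbol" where
  "elem_annihilation i j a = (if a i \<and> a j then a(i := False, j := False) else a)"

text \<open>
  The list gives the pairs in order of application, so the head is applied first. The empty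
  composition is allowed; for \<open>N = 1\<close>, where no pair \<open>i \<noteq> j\<close> exists, it is the only one.
\<close>

definition annihilation_rule :: "('n symbol \<Rightarrow> 'n symbol) \<Rightarrow> bool" where
  "annihilation_rule h \<longleftrightarrow>
     (\<exists>ps. (\<forall>(i, j)\<in>set ps. i \<noteq> j) \<and> h = fold (\<lambda>(i, j). elem_annihilation i j) ps)"

definition gliders_CA :: "(('d::finite, 'n) config \<Rightarrow> ('d, 'n) config) \<Rightarrow> bool" where
  "gliders_CA G \<longleftrightarrow> (\<exists>v. G = gliders v)"

definition annihilation_CA :: "(('d::finite, 'n) config \<Rightarrow> ('d, 'n) config) \<Rightarrow> bool" where
  "annihilation_CA A \<longleftrightarrow> (\<exists>h. annihilation_rule h \<and> A = (\<lambda>x k. h (x k)))"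

definition gliders_with_annihilation :: "(('d::finite, 'n) config \<Rightarrow> ('d, 'n) config) \<Rightarrow> bool" where
  "gliders_with_annihilation F \<longleftrightarrow>
     (\<exists>A G. annihilation_CA A \<and> gliders_CA G \<and> F = A \<circ> G)"


section \<open>Birth-death noise\<close>

text \<open>Entry \<open>(a, b)\<close> of the matrix with rows \<open>(1 - \<beta>, \<beta>)\<close> and \<open>(\<delta>, 1 - \<delta>)\<close>.\<close>

definition bd_matrix :: "real \<Rightarrow> real \<Rightarrow> bool \<Rightarrow> bool \<Rightarrow> real" where
  "bd_matrix \<beta> \<delta> a b =
     (if a then (if b then 1 - \<delta> else \<delta>) else (if b then \<beta> else 1 - \<beta>))"

definition birth_death_noise ::
    "('n::finite \<Rightarrow> real) \<Rightarrow> ('n \<Rightarrow> real) \<Rightarrow> 'n symbol \<Rightarrow> 'n symbol \<Rightarrow> real" where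
  "birth_death_noise \<beta> \<delta> a b = (\<Prod>i\<in>UNIV. bd_matrix (\<beta> i) (\<delta> i) (a i) (b i))"

definition positive_birth_death_noise :: "('n::finite symbol \<Rightarrow> 'n symbol \<Rightarrow> real) \<Rightarrow> bool" where
  "positive_birth_death_noise \<theta> \<longleftrightarrow>
     (\<exists>\<beta> \<delta>. (\<forall>i. \<beta> i \<in> {0<..<1} \<and> \<delta> i \<in> {0<..<1}) \<and> \<theta> = birth_death_noise \<beta> \<delta>)"

definition stochastic_matrix :: "('s::finite \<Rightarrow> 's \<Rightarrow> real) \<Rightarrow> bool" where
  "stochastic_matrix \<theta> \<longleftrightarrow> (\<forall>a b. 0 \<le> \<theta> a b) \<and> (\<forall>a. (\<Sum>b\<in>UNIV. \<theta> a b) = 1)"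


section \<open>Markov kernels\<close>

text \<open>
  A Markov kernel is a measurable map into the Giry monad of probability measures; the monadic
  bind \<open>\<pi> \<bind> \<Phi>\<close> is the measure \<open>\<pi>\<Phi>\<close>, that is, \<open>B \<mapsto> \<integral> \<Phi>(x, B) \<pi>(dx)\<close>.
\<close>

type_synonym ('d, 'n) kernel = "('d, 'n) config \<Rightarrow> ('d, 'n) config measure"

definition is_noisy_version ::
    "(('d::finite, 'n::finite) config \<Rightarrow> ('d, 'n) config) \<Rightarrow> ('n symbol \<Rightarrow> 'n symbol \<Rightarrow> real) \<Rightarrow>
     ('d, 'n) kernel \<Rightarrow> bool" where
  "is_noisy_version F \<theta> \<Phi> \<longleftrightarrow>
     \<Phi> \<in> borel \<rightarrow>\<^sub>M prob_algebra borel \<and>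
     (\<forall>x K y. finite K \<longrightarrow> measure (\<Phi> x) (cylinder K y) = (\<Prod>k\<in>K. \<theta> (F x k) (y k)))"

text \<open>Existence and uniqueness are proved in \<open>noisy_version_unique_existence\<close> below.\<close>

definition noisy_version ::
    "(('d::finite, 'n::finite) config \<Rightarrow> ('d, 'n) config) \<Rightarrow> ('n symbol \<Rightarrow> 'n symbol \<Rightarrow> real) \<Rightarrow>
     ('d, 'n) kernel" where
  "noisy_version F \<theta> = (THE \<Phi>. is_noisy_version F \<theta> \<Phi>)"

primrec kernel_power :: "('d::finite, 'n::finite) kernel \<Rightarrow> nat \<Rightarrow> ('d, 'n) kernel" where
  "kernel_power \<Phi> 0 = (\<lambda>x. return borel x)"
| "kernel_power \<Phi> (Suc t) = (\<lambda>x. kernel_power \<Phi> t x \<bind> \<Phi>)"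

definition invariant_measure ::
    "('d::finite, 'n::finite) kernel \<Rightarrow> ('d, 'n) config measure \<Rightarrow> bool" where
  "invariant_measure \<Phi> \<pi> \<longleftrightarrow> sets \<pi> = sets borel \<and> prob_space \<pi> \<and> \<pi> \<bind> \<Phi> = \<pi>"

definition uniformly_ergodic :: "('d::finite, 'n::finite) kernel \<Rightarrow> bool" where
  "uniformly_ergodic \<Phi> \<longleftrightarrow>
     (\<exists>\<pi>. invariant_measure \<Phi> \<pi> \<and> (\<forall>\<pi>'. invariant_measure \<Phi> \<pi>' \<longrightarrow> \<pi>' = \<pi>) \<and>
        (\<forall>K u. finite K \<longrightarrow>
           uniform_limit UNIV (\<lambda>t x. measure (kernel_power \<Phi> t x) (cylinder K u))
             (\<lambda>x. measure \<pi> (cylinder K u)) sequentially))"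

text \<open>On the discrete infinite group of sites, \<open>k \<rightarrow> \<infinity>\<close> is convergence along cofinite sets.\<close>

definition spatially_mixing :: "('d::finite, 'n::finite) config measure \<Rightarrow> bool" where
  "spatially_mixing \<pi> \<longleftrightarrow>
     (\<forall>K L u v. finite K \<longrightarrow> finite L \<longrightarrow>
        ((\<lambda>k. measure \<pi> (cylinder K u \<inter> shift k -` cylinder L v))
           \<longlongrightarrow> measure \<pi> (cylinder K u) * measure \<pi> (cylinder L v)) cofinite)"


section \<open>The noisy version is well defined\<close>

instance bool :: second_countable_topology
proof
  show "\<exists>B::bool set set. countable B \<and> open = generate_topology B"
  proof (intro exI conjI)
    show "countable (UNIV :: bool set set)" by (rule countable_finite) simp
    show "open = generate_topology (UNIV :: bool set set)"
    proof
      fix A :: "bool set"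
      have "open A" by (rule Topological_Spaces.open_discrete)
      moreover have "generate_topology UNIV A" by (rule generate_topology.Basis) simp
      ultimately show "open A = generate_topology UNIV A" by blast
    qed
  qed
qed

lemma open_symbol: "open (A :: 'n::finite symbol set)"
proof -
  have "open {a}" for a :: "'n symbol"
  proof -
    have "open {f :: 'n symbol. \<forall>i\<in>UNIV. f i \<in> {a i}}"
      by (rule product_topology_basis') (auto intro: Topological_Spaces.open_discrete)
    also have "{f. \<forall>i\<in>UNIV. f i \<in> {a i}} = {a}" by auto
    finally show ?thesis .
  qed
  then have "open (\<Union>a\<in>A. {a})" by (intro open_UN) auto
  then show ?thesis by simp
qed

lemma sets_borel_symbol: "sets (borel :: 'n::finite symbol measure) = UNIV"
  by (auto intro: borel_open open_symbol)

lemma sets_borel_config: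
  "sets (borel :: ('d::finite, 'n::finite) config measure) = sets (PiM UNIV (\<lambda>_. count_space UNIV))"
proof -
  have "sets (PiM UNIV (\<lambda>_::'d site. count_space (UNIV :: 'n symbol set)))
        = sets (PiM UNIV (\<lambda>_::'d site. borel :: 'n symbol measure))"
    by (rule sets_PiM_cong) (auto simp: sets_borel_symbol)
  then show ?thesis by (simp add: sets_PiM_equal_borel)
qed

definition cylinders :: "('d::finite, 'n::finite) config set set" where
  "cylinders = insert {} {cylinder K y |K y. finite K}"

lemma Int_stable_cylinders: "Int_stable (cylinders :: ('d::finite, 'n::finite) config set set)"
proof (rule Int_stableI)
  fix A B :: "('d, 'n) config set"
  assume A: "A \<in> cylinders" and B: "B \<in> cylinders"
  show "A \<inter> B \<in> cylinders"
  proof (cases "A \<inter> B = {}")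
    case False
    then obtain x where x: "x \<in> A" "x \<in> B" by auto
    obtain K y where K: "finite K" "A = cylinder K y"
      using A x unfolding cylinders_def by auto
    obtain L z where L: "finite L" "B = cylinder L z"
      using B x unfolding cylinders_def by auto
    have "A \<inter> B = cylinder (K \<union> L) x"
      using x unfolding K L cylinder_def by auto
    then show ?thesis
      using K L unfolding cylinders_def by auto
  qed (simp add: cylinders_def)
qed

lemma cylinder_prod_emb:
  "cylinder K y = prod_emb UNIV (\<lambda>_. count_space UNIV) K (PiE K (\<lambda>k. {y k}))"
  unfolding cylinder_def prod_emb_def by (auto simp: PiE_def Pi_def)

lemma cylinder_sets:
  assumes "finite K"
  shows "cylinder K y \<in> sets (borel :: ('d::finite, 'n::finite) config measure)"
  unfolding sets_borel_config cylinder_prod_emb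
  by (rule sets_PiM_I) (use assms in auto)

lemma sets_borel_cylinders:
  "sets (borel :: ('d::finite, 'n::finite) config measure) = sigma_sets UNIV cylinders"
proof
  show "sigma_sets UNIV cylinders \<subseteq> sets (borel :: ('d, 'n) config measure)"
    by (rule sets.sigma_sets_subset[where M = borel, simplified])
       (auto simp: cylinders_def cylinder_sets)
  have single: "{x :: ('d, 'n) config. x k \<in> A} \<in> sigma_sets UNIV cylinders" for k A
  proof -
    interpret sigma_algebra UNIV "sigma_sets UNIV (cylinders :: ('d, 'n) config set set)"
      by (rule sigma_algebra_sigma_sets) simp
    have "(\<Union>a\<in>A. cylinder {k} (\<lambda>_. a)) \<in> sigma_sets UNIV (cylinders :: ('d, 'n) config set set)"
    proof (rule finite_UN)
      show "finite A" by simp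
      fix a assume "a \<in> A"
      show "cylinder {k} (\<lambda>_. a) \<in> sigma_sets UNIV (cylinders :: ('d, 'n) config set set)"
        by (rule sigma_sets.Basic) (auto simp: cylinders_def)
    qed
    also have "(\<Union>a\<in>A. cylinder {k} (\<lambda>_. a)) = {x :: ('d, 'n) config. x k \<in> A}"
      by (auto simp: cylinder_def)
    finally show ?thesis .
  qed
  show "sets (borel :: ('d, 'n) config measure) \<subseteq> sigma_sets UNIV cylinders"
  proof -
    have "sigma_sets UNIV {{f :: ('d, 'n) config. f i \<in> A} |i A. True} \<subseteq> sigma_sets UNIV cylinders"
      by (rule sigma_sets_mono) (auto simp: single)
    then show ?thesis unfolding sets_borel_config sets_PiM_single by simp
  qed
qed

lemma stochastic_birth_death_noise:
  assumes "\<And>i. \<beta> i \<in> {0..1}" "\<And>i. \<delta> i \<in> {0..1}"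
  shows "stochastic_matrix (birth_death_noise \<beta> \<delta>)"
  unfolding stochastic_matrix_def
proof safe
  fix a b :: "'a symbol"
  show "0 \<le> birth_death_noise \<beta> \<delta> a b"
    unfolding birth_death_noise_def bd_matrix_def
    using assms by (intro prod_nonneg) auto
next
  fix a :: "'a symbol"
  have "(\<Sum>b\<in>UNIV. birth_death_noise \<beta> \<delta> a b)
        = (\<Sum>b\<in>PiE UNIV (\<lambda>_. UNIV). \<Prod>i\<in>UNIV. bd_matrix (\<beta> i) (\<delta> i) (a i) (b i))"
    unfolding birth_death_noise_def by (simp add: PiE_UNIV_domain)
  also have "\<dots> = (\<Prod>i\<in>UNIV. \<Sum>c\<in>UNIV. bd_matrix (\<beta> i) (\<delta> i) (a i) c)"
    by (rule prod_sum_PiE[symmetric]) auto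
  also have "\<dots> = 1"
    by (rule prod.neutral) (auto simp: bd_matrix_def UNIV_bool)
  finally show "(\<Sum>b\<in>UNIV. birth_death_noise \<beta> \<delta> a b) = 1" .
qed

lemma noisy_version_unique_existence:
  fixes F :: "('d::finite, 'n::finite) config \<Rightarrow> ('d, 'n) config"
  assumes F: "F \<in> borel \<rightarrow>\<^sub>M borel" and \<theta>: "stochastic_matrix \<theta>"
  shows "\<exists>!\<Phi>. is_noisy_version F \<theta> \<Phi>"
proof (rule ex_ex1I)
  have nn: "(\<integral>\<^sup>+b. ennreal (\<theta> a b) \<partial>count_space UNIV) = 1" for a
    using \<theta> by (simp add: stochastic_matrix_def nn_integral_count_space_finite sum_ennreal)
  have pmf: "pmf (embed_pmf (\<theta> a)) b = \<theta> a b" for a b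
    by (rule pmf_embed_pmf) (use \<theta> nn in \<open>auto simp: stochastic_matrix_def\<close>)
  define \<mu> where "\<mu> x = PiM (UNIV :: 'd site set) (\<lambda>k. measure_pmf (embed_pmf (\<theta> (F x k))))" for x
  have prob: "prob_space (\<mu> x)" for x
    unfolding \<mu>_def by (rule prob_space_PiM) (rule prob_space_measure_pmf)
  have sets_\<mu>: "sets (\<mu> x) = sets borel" for x
    unfolding \<mu>_def sets_borel_config by (rule sets_PiM_cong) auto
  have emb: "cylinder K y = prod_emb UNIV (\<lambda>k. measure_pmf (embed_pmf (\<theta> (F x k)))) K (PiE K (\<lambda>k. {y k}))"
    for K x and y :: "('d, 'n) config"
    unfolding cylinder_def prod_emb_def by (auto simp: PiE_def Pi_def)
  have cyl: "emeasure (\<mu> x) (cylinder K y) = ennreal (\<Prod>k\<in>K. \<theta> (F x k) (y k))" if "finite K" for x K y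
  proof -
    have "emeasure (\<mu> x) (cylinder K y)
          = (\<Prod>k\<in>K. emeasure (measure_pmf (embed_pmf (\<theta> (F x k)))) {y k})"
      unfolding \<mu>_def emb[of K y x]
      by (rule emeasure_PiM_emb) (use that in \<open>auto simp: prob_space_measure_pmf\<close>)
    also have "\<dots> = (\<Prod>k\<in>K. ennreal (\<theta> (F x k) (y k)))"
      by (simp add: emeasure_pmf_single pmf)
    also have "\<dots> = ennreal (\<Prod>k\<in>K. \<theta> (F x k) (y k))"
      by (rule prod_ennreal) (use \<theta> in \<open>auto simp: stochastic_matrix_def\<close>)
    finally show ?thesis .
  qed
  have meas: "(\<lambda>x. \<theta> (F x k) b) \<in> borel_measurable borel" for k b
  proof -
    have "(\<lambda>x. F x k) \<in> borel \<rightarrow>\<^sub>M count_space UNIV"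
    proof -
      have "(\<lambda>z::('d, 'n) config. z k) \<in> borel \<rightarrow>\<^sub>M count_space UNIV"
        by (subst measurable_cong_sets[OF sets_borel_config refl])
           (rule measurable_component_singleton, simp)
      from measurable_compose[OF F this] show ?thesis .
    qed
    then show ?thesis by (rule measurable_compose) simp
  qed
  have "\<mu> \<in> borel \<rightarrow>\<^sub>M prob_algebra borel"
  proof (rule measurable_prob_algebra_generated[OF sets_borel_cylinders Int_stable_cylinders])
    fix A :: "('d, 'n) config set" assume "A \<in> cylinders"
    then consider "A = {}" | K y where "finite K" "A = cylinder K y"
      unfolding cylinders_def by auto
    then show "(\<lambda>x. emeasure (\<mu> x) A) \<in> borel_measurable borel"
    proof cases
      case 2
      show ?thesis unfolding 2(2) cyl[OF 2(1)]
        by (intro measurable_compose[OF _ measurable_ennreal] borel_measurable_prod meas)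
    qed simp
  qed (simp_all add: prob sets_\<mu>)
  moreover have "measure (\<mu> x) (cylinder K y) = (\<Prod>k\<in>K. \<theta> (F x k) (y k))" if "finite K" for x K y
    unfolding measure_def cyl[OF that]
    by (rule enn2real_ennreal, rule prod_nonneg) (use \<theta> in \<open>auto simp: stochastic_matrix_def\<close>)
  ultimately have "is_noisy_version F \<theta> \<mu>"
    unfolding is_noisy_version_def by auto
  then show "\<exists>\<Phi>. is_noisy_version F \<theta> \<Phi>" by (intro exI[where x = \<mu>])
next
  fix \<Phi> \<Psi> assume \<Phi>: "is_noisy_version F \<theta> \<Phi>" and \<Psi>: "is_noisy_version F \<theta> \<Psi>"
  show "\<Phi> = \<Psi>"
  proof
    fix x
    have "\<Phi> x \<in> space (prob_algebra borel)" "\<Psi> x \<in> space (prob_algebra borel)"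
      using \<Phi> \<Psi> unfolding is_noisy_version_def by (auto intro: measurable_space)
    then have p: "prob_space (\<Phi> x)" "prob_space (\<Psi> x)"
      and s: "sets (\<Phi> x) = sets borel" "sets (\<Psi> x) = sets borel"
      by (auto simp: space_prob_algebra)
    interpret P: prob_space "\<Phi> x" by (rule p)
    interpret Q: prob_space "\<Psi> x" by (rule p)
    show "\<Phi> x = \<Psi> x"
    proof (rule measure_eqI_generator_eq[OF Int_stable_cylinders, where A = "\<lambda>_. UNIV"])
      fix A :: "('d, 'n) config set" assume "A \<in> cylinders"
      then show "emeasure (\<Phi> x) A = emeasure (\<Psi> x) A"
        using \<Phi> \<Psi> unfolding cylinders_def is_noisy_version_def
        by (auto simp: P.emeasure_eq_measure Q.emeasure_eq_measure)
    next
      have "cylinder {} y = (UNIV :: ('d, 'n) config set)" for y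
        by (simp add: cylinder_def)
      then show "range (\<lambda>_::nat. UNIV) \<subseteq> (cylinders :: ('d, 'n) config set set)"
        unfolding cylinders_def by blast
    qed (simp_all add: s sets_borel_cylinders)
  qed
qed

lemma measurable_gliders_with_annihilation:
  fixes F :: "('d::finite, 'n::finite) config \<Rightarrow> ('d, 'n) config"
  assumes "gliders_with_annihilation F"
  shows "F \<in> borel \<rightarrow>\<^sub>M borel"
proof -
  obtain h v where F: "F = (\<lambda>x k. h (\<lambda>i. x (k + v i) i))"
    using assms unfolding gliders_with_annihilation_def annihilation_CA_def gliders_CA_def
      gliders_def by (auto simp: o_def)
  have h: "continuous_on UNIV h" for h :: "'n symbol \<Rightarrow> 'n symbol"
  proof -
    show ?thesis by (simp add: continuous_on_open_vimage open_symbol)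
  qed
  have comp: "continuous_on UNIV (\<lambda>x::('d, 'n) config. x k i)" for k i
    by (rule continuous_on_product_then_coordinatewise[OF continuous_on_product_coordinates])
  have "continuous_on UNIV (\<lambda>x::('d, 'n) config. (\<lambda>i. x (k + v i) i))" for k
    by (rule continuous_on_coordinatewise_then_product) (rule comp)
  then have "continuous_on UNIV (\<lambda>x::('d, 'n) config. h (\<lambda>i. x (k + v i) i))" for k
    by (rule continuous_on_compose2[OF h]) simp
  then have "continuous_on UNIV F"
    unfolding F by (rule continuous_on_coordinatewise_then_product)
  then show ?thesis by (rule borel_measurable_continuous_onI)
qed

lemma is_noisy_version_noisy_version:
  assumes "gliders_with_annihilation F" and "positive_birth_death_noise \<theta>"
  shows "is_noisy_version F \<theta> (noisy_version F \<theta>)"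
proof -
  obtain \<beta> \<delta> where bd: "\<And>i. \<beta> i \<in> {0<..<1} \<and> \<delta> i \<in> {0<..<1}" and \<theta>: "\<theta> = birth_death_noise \<beta> \<delta>"
    using assms(2) unfolding positive_birth_death_noise_def by auto
  have "stochastic_matrix \<theta>" unfolding \<theta>
    by (rule stochastic_birth_death_noise) (use bd in \<open>auto simp: less_imp_le\<close>)
  from noisy_version_unique_existence[OF measurable_gliders_with_annihilation[OF assms(1)] this]
  show ?thesis unfolding noisy_version_def by (rule theI')
qed

end

theory Submission
  imports Defs
begin

text \<open>
  Start two configurations that differ in a single component. A glider moves a discrepancy without
  copying it, and an annihilation either leaves it, moves it to another type, or cancels it, so the
  deterministic map is 1-Lipschitz for the Hamming distance. The noise on type \<open>i\<close> multiplies the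
  total variation carried by a discrepancy by \<open>\<bar>1 - \<beta>\<^sub>i - \<delta>\<^sub>i\<bar> < 1\<close>. Hence the transition operator
  contracts the Hamming-Lipschitz constant of a local function geometrically, while the number of
  sites on which the iterates depend grows only polynomially: their oscillation tends to \<open>0\<close>, and
  the iterates converge uniformly to constants. These constants are the integrals with respect to a
  measure obtained from Kolmogorov's extension theorem. Mixing holds because, for far apart local
  functions \<open>f\<close> and \<open>g\<close>, the \<open>t\<close>-th iterate of \<open>f g\<close> is the product of the iterates.
\<close>


section \<open>Kolmogorov extension over a finite alphabet\<close>

text \<open>Consistency under adding one site gives both claims by induction on finite sets: the
  total mass stays 1, and every restriction carries \<open>q H\<close> to \<open>q J\<close>. A
  pattern on \<open>K\<close> is encoded by its extensional function, so that it is a single point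
  of the function type.\<close>

lemma consistent_family_marginal:
  fixes p :: "'i set \<Rightarrow> ('i \<Rightarrow> 'a::finite) \<Rightarrow> real"
  assumes nonneg: "\<And>K y. finite K \<Longrightarrow> 0 \<le> p K y"
    and empty: "\<And>y. p {} y = 1"
    and cons: "\<And>K k y. finite K \<Longrightarrow> k \<notin> K \<Longrightarrow> p K y = (\<Sum>a\<in>UNIV. p (insert k K) (y(k := a)))"
  obtains q :: "'i set \<Rightarrow> ('i \<Rightarrow> 'a) pmf"
  where "\<And>K y. finite K \<Longrightarrow> pmf (q K) y = (if y \<in> extensional K then p K y else 0)"
    and "\<And>J H. finite H \<Longrightarrow> J \<subseteq> H \<Longrightarrow> map_pmf (\<lambda>y. restrict y J) (q H) = q J"
proof -
  define q where "q K = embed_pmf (\<lambda>y. if y \<in> extensional K then p K y else 0)" for K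
  have ext: "extensional K = PiE K (\<lambda>_. UNIV :: 'a set)" for K :: "'i set"
    by (auto simp: PiE_def)
  have fin: "finite (extensional K :: ('i \<Rightarrow> 'a) set)" if "finite K" for K
    unfolding ext using that by (rule finite_PiE) simp
  have sum1: "(\<Sum>y\<in>extensional K. p K y) = 1" if "finite K" for K
    using that
  proof (induction K)
    case empty
    then show ?case by (simp add: assms(2))
  next
    case (insert k K)
    have inj: "inj_on (\<lambda>(a, y). y(k := a)) (UNIV \<times> extensional K :: ('a \<times> ('i \<Rightarrow> 'a)) set)"
      unfolding ext by (rule inj_combinator) (use insert in auto)
    have "(\<Sum>y\<in>extensional (insert k K). p (insert k K) y)
        = (\<Sum>(a, y)\<in>UNIV \<times> extensional K. p (insert k K) (y(k := a)))"
      unfolding ext PiE_insert_eq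
      by (subst sum.reindex[OF inj[unfolded ext]]) (simp add: case_prod_unfold)
    also have "\<dots> = (\<Sum>a\<in>UNIV. \<Sum>y\<in>extensional K. p (insert k K) (y(k := a)))"
      by (simp add: sum.cartesian_product)
    also have "\<dots> = (\<Sum>y\<in>extensional K. p K y)"
      by (subst sum.swap) (simp add: cons[OF insert(1,2)])
    finally show ?case using insert by simp
  qed
  have pmf_q: "pmf (q K) y = (if y \<in> extensional K then p K y else 0)" if "finite K" for K y
    unfolding q_def
  proof (rule pmf_embed_pmf)
    have "(\<integral>\<^sup>+y. ennreal (if y \<in> extensional K then p K y else 0) \<partial>count_space UNIV)
        = (\<Sum>y\<in>extensional K. ennreal (p K y))"
      by (subst nn_integral_count_space'[OF fin[OF that]]) (auto intro: sum.cong)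
    also have "\<dots> = 1"
      using nonneg[OF that] sum1[OF that] by (subst sum_ennreal) auto
    finally show "(\<integral>\<^sup>+y. ennreal (if y \<in> extensional K then p K y else 0) \<partial>count_space UNIV) = 1" .
  qed (use nonneg that in auto)
  have step: "map_pmf (\<lambda>y. restrict y K) (q (insert k K)) = q K" if K: "finite K" "k \<notin> K" for k K
  proof (rule pmf_eqI)
    fix y
    have supp: "z \<in> extensional (insert k K)" if "z \<in> set_pmf (q (insert k K))" for z
      using that K by (auto simp: set_pmf_iff pmf_q split: if_splits)
    have "pmf (map_pmf (\<lambda>y. restrict y K) (q (insert k K))) y
        = measure (q (insert k K)) ((\<lambda>z. restrict z K) -` {y})"
      by (rule pmf_map)
    \<comment> \<open>Up to null sets only extensional functions count. Among them the fibre of the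
      restriction over \<open>y\<close> is the finite set of all \<open>y(k := a)\<close>, and the
      consistency condition sums its mass.\<close>
    also have "\<dots> = measure (q (insert k K)) ((\<lambda>z. restrict z K) -` {y} \<inter> extensional (insert k K))"
      by (rule measure_pmf.finite_measure_eq_AE) (auto simp: AE_measure_pmf_iff supp)
    also have "\<dots> = pmf (q K) y"
    proof (cases "y \<in> extensional K")
      case True
      have "(\<lambda>z. restrict z K) -` {y} \<inter> extensional (insert k K) = range (\<lambda>a. y(k := a))"
      proof safe
        fix z :: "'i \<Rightarrow> 'a" assume z: "z \<in> extensional (insert k K)"
        have "z = (restrict z K)(k := z k)"
          using z by (auto simp: fun_eq_iff extensional_def)
        then show "z \<in> range (\<lambda>a. (restrict z K)(k := a))" by (rule range_eqI)
      qed (use True K in \<open>auto simp: fun_eq_iff extensional_def\<close>)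
      moreover have "inj (\<lambda>a. y(k := a))"
        by (auto simp: inj_on_def fun_eq_iff)
      moreover have "y(k := a) \<in> extensional (insert k K)" for a
        using True by (auto simp: extensional_def)
      ultimately show ?thesis
        using True K by (simp add: measure_measure_pmf_finite sum.reindex pmf_q cons[OF K])
    next
      case False
      then have "(\<lambda>z. restrict z K) -` {y} \<inter> extensional (insert k K) = {}" by auto
      with False K show ?thesis by (simp add: pmf_q)
    qed
    finally show "pmf (map_pmf (\<lambda>y. restrict y K) (q (insert k K))) y = pmf (q K) y" .
  qed
  \<comment> \<open>The larger set is written as \<open>J \<union> D\<close>, and the sites of
    \<open>D\<close> are dropped one at a time.\<close>
  have "map_pmf (\<lambda>y. restrict y J) (q (J \<union> D)) = q J" if "finite D" "finite J" for J D
    using that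
  proof (induction D)
    case empty
    have "map_pmf (\<lambda>y. restrict y J) (q J) = map_pmf id (q J)"
      by (rule map_pmf_cong)
         (use empty in \<open>auto simp: set_pmf_iff pmf_q extensional_restrict split: if_splits\<close>)
    then show ?case by (simp only: pmf.map_id id_apply Un_empty_right)
  next
    case (insert k D)
    show ?case
    proof (cases "k \<in> J")
      case True
      then show ?thesis using insert by (simp add: insert_absorb)
    next
      case False
      have "map_pmf (\<lambda>y. restrict y J) (q (insert k (J \<union> D)))
          = map_pmf (\<lambda>y. restrict y J) (map_pmf (\<lambda>y. restrict y (J \<union> D)) (q (insert k (J \<union> D))))"
        by (simp add: map_pmf_comp Int_absorb1 Int_commute)
      also have "map_pmf (\<lambda>y. restrict y (J \<union> D)) (q (insert k (J \<union> D))) = q (J \<union> D)"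
        by (rule step) (use insert False in auto)
      also have "map_pmf (\<lambda>y. restrict y J) \<dots> = q J" by (rule insert.IH[OF insert.prems])
      finally show ?thesis by simp
    qed
  qed
  then have "map_pmf (\<lambda>y. restrict y J) (q H) = q J" if "finite H" "J \<subseteq> H" for J H
    using that by (metis Un_absorb1 finite_subset)
  with pmf_q show ?thesis by (rule that)
qed

text \<open>The consistent laws are transported to real-valued families by an injective coding, the
  projective limit is formed there, and its coordinates are decoded. Since \<open>p K\<close>
  receives a function on the whole index set, \<open>cong\<close> expresses that it sees only the
  values on \<open>K\<close>.\<close>

lemma kolmogorov_extension_finite:
  fixes p :: "'i set \<Rightarrow> ('i \<Rightarrow> 'a::finite) \<Rightarrow> real"
  assumes nonneg: "\<And>K y. finite K \<Longrightarrow> 0 \<le> p K y"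
    and empty: "\<And>y. p {} y = 1"
    and cong: "\<And>K y z. finite K \<Longrightarrow> (\<And>k. k \<in> K \<Longrightarrow> y k = z k) \<Longrightarrow> p K y = p K z"
    and cons: "\<And>K k y. finite K \<Longrightarrow> k \<notin> K \<Longrightarrow> p K y = (\<Sum>a\<in>UNIV. p (insert k K) (y(k := a)))"
  obtains M where "prob_space M" "sets M = sets (PiM UNIV (\<lambda>_. count_space UNIV))"
    and "\<And>K y. finite K \<Longrightarrow> measure M {x. \<forall>k\<in>K. x k = y k} = p K y"
proof -
  obtain q :: "'i set \<Rightarrow> ('i \<Rightarrow> 'a) pmf"
    where q: "\<And>K y. finite K \<Longrightarrow> pmf (q K) y = (if y \<in> extensional K then p K y else 0)"
      and map_q: "\<And>J H. finite H \<Longrightarrow> J \<subseteq> H \<Longrightarrow> map_pmf (\<lambda>y. restrict y J) (q H) = q J"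
    using consistent_family_marginal[of p, OF nonneg empty cons] by metis
  \<comment> \<open>The library's extension theorem needs a Polish alphabet, so symbols are coded as reals.\<close>
  obtain e :: "'a \<Rightarrow> real" where e: "inj e"
    by (rule that[of "real \<circ> to_nat_on UNIV"]) (auto intro!: inj_compose simp: uncountable_infinite countable_finite inj_on_def)
  define P where "P J = distr (q J) (PiM J (\<lambda>_. borel)) (\<lambda>y. \<lambda>k\<in>J. e (y k))" for J
  have meas: "(\<lambda>y. \<lambda>k\<in>J. e (y k)) \<in> measure_pmf (q H) \<rightarrow>\<^sub>M PiM J (\<lambda>_. borel)" for J H
    by (auto simp: space_PiM)
  interpret polish_projective UNIV P
  proof (rule polish_projective.intro, rule projective_family.intro)
    fix J H :: "'i set" assume JH: "J \<subseteq> H" "finite H"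
    have "distr (P H) (PiM J (\<lambda>_. borel)) (\<lambda>f. restrict f J)
        = distr (q H) (PiM J (\<lambda>_. borel)) ((\<lambda>f. restrict f J) \<circ> (\<lambda>y. \<lambda>k\<in>H. e (y k)))"
      unfolding P_def by (rule distr_distr[OF measurable_restrict_subset[OF JH(1)] meas])
    also have "(\<lambda>f. restrict f J) \<circ> (\<lambda>y. \<lambda>k\<in>H. e (y k))
        = (\<lambda>y. \<lambda>k\<in>J. e (y k)) \<circ> (\<lambda>y. restrict y J)"
      using JH by (auto simp: fun_eq_iff restrict_def)
    also have "distr (q H) (PiM J (\<lambda>_. borel)) \<dots>
        = distr (distr (q H) (count_space UNIV) (\<lambda>y. restrict y J)) (PiM J (\<lambda>_. borel)) (\<lambda>y. \<lambda>k\<in>J. e (y k))"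
      by (rule distr_distr[symmetric]) (auto simp: space_PiM)
    also have "distr (q H) (count_space UNIV) (\<lambda>y. restrict y J) = q J"
      using map_q[OF JH(2,1)] by (metis map_pmf_rep_eq)
    also have "distr (q J) (PiM J (\<lambda>_. borel)) (\<lambda>y. \<lambda>k\<in>J. e (y k)) = P J"
      by (simp only: P_def)
    finally show "P J = distr (P H) (PiM J (\<lambda>_. borel)) (\<lambda>f. restrict f J)"
      by (rule sym)
  next
    fix J show "prob_space (P J)"
      unfolding P_def by (rule measure_pmf.prob_space_distr[OF meas])
  qed
  let ?N = "PiM (UNIV :: 'i set) (\<lambda>_. count_space (UNIV :: 'a set))"
  \<comment> \<open>A left inverse of the coding. Off the finite range of \<open>e\<close> it takes
    one fixed value, so each fibre is finite or cofinite, hence Borel.\<close>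
  define d where "d r = inv e r" for r
  have d: "d \<in> borel \<rightarrow>\<^sub>M count_space UNIV"
  proof (rule measurable_count_space_eq2[THEN iffD2])
    have "d -` {a} \<in> sets borel" for a
    proof (cases "\<forall>r. r \<notin> range e \<longrightarrow> d r \<noteq> a")
      case True
      have "d -` {a} \<subseteq> range e" using True by auto
      then have "finite (d -` {a})" by (rule finite_subset) simp
      then show ?thesis by (intro borel_closed finite_imp_closed)
    next
      case False
      then have "d r = a" if "r \<notin> range e" for r
        using that by (auto simp: d_def inv_def intro!: arg_cong[where f = Eps])
      then have "- (d -` {a}) \<subseteq> range e" by auto
      then have "finite (- (d -` {a}))" by (rule finite_subset) simp
      then have "- (- (d -` {a})) \<in> sets borel"
        by (intro borel_comp borel_closed finite_imp_closed)
      then show ?thesis by simp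
    qed
    then show "d \<in> space borel \<rightarrow> UNIV \<and> (\<forall>a\<in>UNIV. d -` {a} \<inter> space borel \<in> sets borel)" by simp
  qed simp
  have decode: "(\<lambda>x k. d (x k)) \<in> lim \<rightarrow>\<^sub>M ?N"
    unfolding measurable_cong_sets[OF sets_lim refl]
    by (rule measurable_PiM_single')
       (auto intro!: measurable_compose[OF _ d] measurable_component_singleton)
  let ?M = "distr lim ?N (\<lambda>x k. d (x k))"
  show ?thesis
  proof (rule that[of ?M])
    show "prob_space ?M" by (rule P.prob_space_distr[OF decode])
    fix K :: "'i set" and y :: "'i \<Rightarrow> 'a" assume K: "finite K"
    have cyl: "{x. \<forall>k\<in>K. x k = y k} = prod_emb UNIV (\<lambda>_. count_space UNIV) K (PiE K (\<lambda>k. {y k}))"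
      unfolding prod_emb_def by (auto simp: PiE_def Pi_def)
    have "measure ?M {x. \<forall>k\<in>K. x k = y k}
        = measure lim ((\<lambda>x k. d (x k)) -` {x. \<forall>k\<in>K. x k = y k} \<inter> space lim)"
      by (rule measure_distr[OF decode]) (unfold cyl, rule sets_PiM_I, use K in auto)
    also have "(\<lambda>x k. d (x k)) -` {x. \<forall>k\<in>K. x k = y k} \<inter> space lim
        = prod_emb UNIV (\<lambda>_. borel) K (PiE K (\<lambda>k. d -` {y k}))"
      unfolding prod_emb_def sets_eq_imp_space_eq[OF sets_lim]
      by (auto simp: PiE_def Pi_def space_PiM)
    also have "measure lim \<dots> = measure (P K) (PiE K (\<lambda>k. d -` {y k}))"
      using measurable_sets[OF d] K by (intro measure_lim_emb sets_PiM_I_finite) auto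
    also have "\<dots> = measure (q K) ((\<lambda>y. \<lambda>k\<in>K. e (y k)) -` PiE K (\<lambda>k. d -` {y k}))"
      unfolding P_def using measurable_sets[OF d] K
      by (subst measure_distr[OF meas]) (auto intro!: sets_PiM_I_finite)
    also have "(\<lambda>y. \<lambda>k\<in>K. e (y k)) -` PiE K (\<lambda>k. d -` {y k}) = {z. restrict z K = restrict y K}"
      by (auto simp: d_def PiE_def Pi_def inv_f_f[OF e] fun_eq_iff restrict_def extensional_def)
    \<comment> \<open>\<open>q K\<close> is carried by extensional functions, and only one of them
      agrees with \<open>y\<close> on \<open>K\<close>.\<close>
    also have "measure (q K) \<dots> = measure (q K) {restrict y K}"
      by (rule measure_pmf.finite_measure_eq_AE)
         (auto simp: AE_measure_pmf_iff set_pmf_iff q K extensional_restrict split: if_splits)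
    also have "\<dots> = p K (restrict y K)"
      using K by (simp add: measure_pmf_single q)
    also have "\<dots> = p K y" by (rule cong) (use K in auto)
    finally show "measure ?M {x. \<forall>k\<in>K. x k = y k} = p K y" .
  qed simp
qed


section \<open>Local functions\<close>

definition depends_on :: "'d::finite site set \<Rightarrow> (('d, 'n::finite) config \<Rightarrow> real) \<Rightarrow> bool" where
  "depends_on K f \<longleftrightarrow> (\<forall>x y. (\<forall>k\<in>K. x k = y k) \<longrightarrow> f x = f y)"

lemma depends_onD: "depends_on K f \<Longrightarrow> (\<And>k. k \<in> K \<Longrightarrow> x k = y k) \<Longrightarrow> f x = f y"
  unfolding depends_on_def by blast

lemma depends_on_mono: "depends_on K f \<Longrightarrow> K \<subseteq> L \<Longrightarrow> depends_on L f"
  unfolding depends_on_def by blast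

lemma depends_on_mult: "depends_on K f \<Longrightarrow> depends_on L g \<Longrightarrow> depends_on (K \<union> L) (\<lambda>x. f x * g x)"
  unfolding depends_on_def by (metis UnCI)

lemma depends_on_indicator_cylinder: "depends_on K (indicator (cylinder K u))"
  unfolding depends_on_def cylinder_def indicator_def by auto

lemma cylinder_cong: "(\<And>k. k \<in> K \<Longrightarrow> y k = z k) \<Longrightarrow> cylinder K y = cylinder K z"
  unfolding cylinder_def by auto

text \<open>One representative configuration for each pattern on \<open>K\<close>: off
  \<open>K\<close> every symbol is empty. The cylinders over these representatives partition the
  configuration space.\<close>

definition patterns :: "'d::finite site set \<Rightarrow> ('d, 'n::finite) config set" where
  "patterns K = PiE_dflt K (\<lambda>_. False) (\<lambda>_. UNIV)"

lemma finite_patterns: "finite K \<Longrightarrow> finite (patterns K)"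
  unfolding patterns_def by (rule finite_PiE_dflt) auto

text \<open>A local function is constant on each block of the partition into cylinders, so
  boundedness, measurability and integrals all reduce to finite sums over cylinders.\<close>

lemma depends_on_eq_sum_indicator:
  assumes K: "finite K" and f: "depends_on K f"
  shows "f x = (\<Sum>u\<in>patterns K. f u * indicator (cylinder K u) x)"
proof -
  define w where "w = (\<lambda>k. if k \<in> K then x k else (\<lambda>_. False))"
  have w: "w \<in> patterns K" "f w = f x" "x \<in> cylinder K w"
    using depends_onD[OF f, of w x] by (auto simp: w_def patterns_def PiE_dflt_def cylinder_def)
  have "(\<Sum>u\<in>patterns K. f u * indicator (cylinder K u) x) = (\<Sum>u\<in>{w}. f u * indicator (cylinder K u) x)"
  proof (rule sum.mono_neutral_right)
    show "\<forall>u\<in>patterns K - {w}. f u * indicator (cylinder K u) x = 0"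
      by (auto simp: indicator_def cylinder_def w_def patterns_def PiE_dflt_def fun_eq_iff)
  qed (use w finite_patterns[OF K] in auto)
  then show ?thesis using w by simp
qed

lemma depends_on_bounded:
  assumes "finite K" "depends_on K f"
  shows "\<bar>f x\<bar> \<le> (\<Sum>u\<in>patterns K. \<bar>f u\<bar>)"
  unfolding depends_on_eq_sum_indicator[OF assms, of x]
  by (rule order_trans[OF sum_abs sum_mono]) (auto simp: indicator_def)

lemma borel_measurable_depends_on:
  assumes "finite K" "depends_on K f"
  shows "f \<in> borel_measurable borel"
proof -
  have "f = (\<lambda>x. \<Sum>u\<in>patterns K. f u * indicator (cylinder K u) x)"
    by (rule ext) (rule depends_on_eq_sum_indicator[OF assms])
  also have "\<dots> \<in> borel_measurable borel"
    by (intro borel_measurable_sum borel_measurable_times borel_measurable_const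
        borel_measurable_indicator cylinder_sets assms)
  finally show ?thesis .
qed

lemma integrable_depends_on:
  assumes "finite K" "depends_on K f" "prob_space M" "sets M = sets borel"
  shows "integrable M f"
proof -
  interpret prob_space M by fact
  have "f \<in> borel_measurable M"
    using borel_measurable_depends_on[OF assms(1,2)] assms(4) by (simp cong: measurable_cong_sets)
  then show ?thesis
    by (intro integrable_const_bound[where B = "\<Sum>u\<in>patterns K. \<bar>f u\<bar>"])
       (auto intro: depends_on_bounded assms)
qed

lemma integral_depends_on:
  assumes K: "finite K" and f: "depends_on K f" and M: "prob_space M" "sets M = sets borel"
  shows "integral\<^sup>L M f = (\<Sum>u\<in>patterns K. f u * measure M (cylinder K u))"
proof -
  interpret prob_space M by fact
  have cyl: "cylinder K u \<in> sets M" for u using cylinder_sets[OF K] M by simp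
  have "integral\<^sup>L M f = (\<integral>x. (\<Sum>u\<in>patterns K. f u * indicator (cylinder K u) x) \<partial>M)"
    by (rule Bochner_Integration.integral_cong) (rule refl, rule depends_on_eq_sum_indicator[OF K f])
  also have "\<dots> = (\<Sum>u\<in>patterns K. \<integral>x. f u * indicator (cylinder K u) x \<partial>M)"
  proof (rule Bochner_Integration.integral_sum)
    have "integrable M (indicator (cylinder K u) :: _ \<Rightarrow> real)" for u
      by (rule integrable_real_indicator[OF cyl]) (simp add: emeasure_eq_measure)
    then show "integrable M (\<lambda>x. f u * indicator (cylinder K u) x)" for u
      by (rule integrable_mult_right)
  qed
  also have "\<dots> = (\<Sum>u\<in>patterns K. f u * measure M (cylinder K u))"
    using cyl[THEN sets.sets_into_space] by (intro sum.cong refl) (simp add: Int_absorb2)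
  finally show ?thesis .
qed

section \<open>Probability measures determined by and constructed from cylinder
  probabilities\<close>

lemma prob_measure_eqI_cylinder:
  fixes M N :: "('d::finite, 'n::finite) config measure"
  assumes M: "prob_space M" "sets M = sets borel" and N: "prob_space N" "sets N = sets borel"
    and eq: "\<And>K u. finite K \<Longrightarrow> measure M (cylinder K u) = measure N (cylinder K u)"
  shows "M = N"
proof -
  interpret M: prob_space M by fact
  interpret N: prob_space N by fact
  show ?thesis
  proof (rule measure_eqI_generator_eq[OF Int_stable_cylinders, where A = "\<lambda>_. UNIV"])
    show "emeasure M A = emeasure N A" if "A \<in> cylinders" for A
      using that eq unfolding cylinders_def
      by (auto simp: M.emeasure_eq_measure N.emeasure_eq_measure)
    have "cylinder {} y = (UNIV :: ('d, 'n) config set)" for y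
      by (simp add: cylinder_def)
    then show "range (\<lambda>_::nat. UNIV) \<subseteq> (cylinders :: ('d, 'n) config set set)"
      unfolding cylinders_def by blast
  qed (simp_all add: M N sets_borel_cylinders)
qed

text \<open>Nonnegativity, normalisation and consistency involve only finite sums of cylinder
  probabilities, so they survive the pointwise limit, and the extension theorem applies to the
  limiting values.\<close>

lemma limit_measure_exists:
  fixes \<mu> :: "nat \<Rightarrow> ('d::finite, 'n::finite) config measure"
  assumes \<mu>: "\<And>t. prob_space (\<mu> t)" "\<And>t. sets (\<mu> t) = sets borel"
    and conv: "\<And>K u. finite K \<Longrightarrow> convergent (\<lambda>t. measure (\<mu> t) (cylinder K u))"
  obtains \<pi> where "prob_space \<pi>" "sets \<pi> = sets borel"
    and "\<And>K u. finite K \<Longrightarrow> (\<lambda>t. measure (\<mu> t) (cylinder K u)) \<longlonglongrightarrow> measure \<pi> (cylinder K u)"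
proof -
  define p where "p K u = lim (\<lambda>t. measure (\<mu> t) (cylinder K u))" for K u
  have lim: "(\<lambda>t. measure (\<mu> t) (cylinder K u)) \<longlonglongrightarrow> p K u" if "finite K" for K u
    using conv[OF that] unfolding p_def by (simp add: convergent_LIMSEQ_iff)
  obtain \<pi> where "prob_space \<pi>" "sets \<pi> = sets (PiM UNIV (\<lambda>_. count_space UNIV))"
    and \<pi>: "\<And>K u. finite K \<Longrightarrow> measure \<pi> {x. \<forall>k\<in>K. x k = u k} = p K u"
  proof (rule kolmogorov_extension_finite[of p])
    fix K :: "'d site set" and u :: "('d, 'n) config" assume K: "finite K"
    show "0 \<le> p K u" by (rule LIMSEQ_le_const[OF lim[OF K]]) simp
    show "p K u = p K w" if "\<And>k. k \<in> K \<Longrightarrow> u k = w k" for w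
      unfolding p_def using cylinder_cong[of K u w] that by simp
    fix k assume k: "k \<notin> K"
    have "measure (\<mu> t) (cylinder K u) = (\<Sum>a\<in>UNIV. measure (\<mu> t) (cylinder (insert k K) (u(k := a))))" for t
    proof -
      interpret prob_space "\<mu> t" by (rule \<mu>)
      have "cylinder K u = (\<Union>a\<in>UNIV. cylinder (insert k K) (u(k := a)))"
        using k by (auto simp: cylinder_def)
      also have "measure (\<mu> t) \<dots> = (\<Sum>a\<in>UNIV. measure (\<mu> t) (cylinder (insert k K) (u(k := a))))"
      proof (rule finite_measure_finite_Union)
        show "disjoint_family_on (\<lambda>a. cylinder (insert k K) (u(k := a))) UNIV"
          by (auto simp: disjoint_family_on_def cylinder_def)
        show "(\<lambda>a. cylinder (insert k K) (u(k := a))) ` UNIV \<subseteq> sets (\<mu> t)"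
          unfolding \<mu> using K by (intro image_subsetI cylinder_sets) simp
      qed simp
      finally show ?thesis .
    qed
    moreover have "(\<lambda>t. \<Sum>a\<in>UNIV. measure (\<mu> t) (cylinder (insert k K) (u(k := a))))
        \<longlonglongrightarrow> (\<Sum>a\<in>UNIV. p (insert k K) (u(k := a)))"
      by (intro tendsto_sum lim) (use K in simp)
    ultimately show "p K u = (\<Sum>a\<in>UNIV. p (insert k K) (u(k := a)))"
      using lim[OF K, of u] by (simp add: LIMSEQ_unique)
  next
    fix u :: "('d, 'n) config"
    have "measure (\<mu> t) (cylinder {} u) = 1" for t
    proof -
      interpret prob_space "\<mu> t" by (rule \<mu>)
      show ?thesis using prob_space sets_eq_imp_space_eq[OF \<mu>(2)[of t]] by (simp add: cylinder_def)
    qed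
    then show "p {} u = 1" by (simp add: p_def)
  qed blast
  then show ?thesis
    using lim by (intro that[of \<pi>]) (auto simp: sets_borel_config cylinder_def)
qed


section \<open>Hamming distance\<close>

definition flip :: "'d::finite site \<Rightarrow> 'n::finite \<Rightarrow> ('d, 'n) config \<Rightarrow> ('d, 'n) config" where
  "flip k i x = x(k := (x k)(i := \<not> x k i))"

text \<open>Only configurations at Hamming distance 1 are compared; longer distances are reached by
  chaining single flips.\<close>

definition hamming_lipschitz :: "real \<Rightarrow> (('d::finite, 'n::finite) config \<Rightarrow> real) \<Rightarrow> bool" where
  "hamming_lipschitz L f \<longleftrightarrow> (\<forall>k i x. \<bar>f (flip k i x) - f x\<bar> \<le> L)"

text \<open>The components listed in \<open>D\<close> are corrected one at a time, each at cost at
  most \<open>L\<close>. An entry of \<open>D\<close> where \<open>x\<close> and \<open>y\<close>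
  already agree costs nothing.\<close>

lemma hamming_lipschitz_dist:
  assumes L: "hamming_lipschitz L f"
    and "finite D" "\<And>k i. (k, i) \<notin> D \<Longrightarrow> x k i = y k i"
  shows "\<bar>f x - f y\<bar> \<le> L * card D"
  using assms(2,3)
proof (induction D arbitrary: x)
  case empty
  then have "x = y" by (auto simp: fun_eq_iff)
  then show ?case by simp
next
  case (insert c D)
  obtain k i where c: "c = (k, i)" by (cases c)
  have L0: "0 \<le> L" using L unfolding hamming_lipschitz_def by (meson abs_ge_zero order_trans)
  show ?case
  proof (cases "x k i = y k i")
    case True
    have "\<bar>f x - f y\<bar> \<le> L * card D"
    proof (rule insert.IH)
      show "x k' i' = y k' i'" if "(k', i') \<notin> D" for k' i'
        using insert.prems[of k' i'] True that c by (cases "(k', i') = c") auto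
    qed
    also have "\<dots> \<le> L * card (insert c D)"
      using L0 insert by (intro mult_left_mono) (auto simp: card_insert_if)
    finally show ?thesis .
  next
    case False
    have "\<bar>f (flip k i x) - f y\<bar> \<le> L * card D"
      using insert.prems c False by (intro insert.IH) (auto simp: flip_def)
    moreover have "\<bar>f (flip k i x) - f x\<bar> \<le> L"
      using L unfolding hamming_lipschitz_def by blast
    ultimately show ?thesis using insert by (simp add: algebra_simps)
  qed
qed

text \<open>Overwriting \<open>x\<close> by \<open>y\<close> on \<open>K\<close> alone already
  produces the value \<open>f y\<close>, and this alters at most \<open>card K * CARD('n)\<close>
  components.\<close>

lemma depends_on_oscillation:
  fixes f :: "('d::finite, 'n::finite) config \<Rightarrow> real"
  assumes f: "hamming_lipschitz L f" "depends_on K f" and K: "finite K"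
  shows "\<bar>f x - f y\<bar> \<le> L * (card K * CARD('n))"
proof -
  define z where "z = (\<lambda>k. if k \<in> K then y k else x k)"
  have "f y = f z" by (rule depends_onD[OF f(2)]) (simp add: z_def)
  moreover have "\<bar>f x - f z\<bar> \<le> L * card (K \<times> (UNIV :: 'n set))"
    by (rule hamming_lipschitz_dist[OF f(1)]) (use K in \<open>auto simp: z_def\<close>)
  ultimately show ?thesis by (simp add: card_cartesian_product)
qed

lemma depends_on_hamming_lipschitz:
  assumes "finite K" "depends_on K f"
  obtains L where "hamming_lipschitz L f"
proof
  have "\<bar>f (flip k i x) - f x\<bar> \<le> 2 * (\<Sum>u\<in>patterns K. \<bar>f u\<bar>)" for k i x
    using depends_on_bounded[OF assms, of x] depends_on_bounded[OF assms, of "flip k i x"] by linarith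
  then show "hamming_lipschitz (2 * (\<Sum>u\<in>patterns K. \<bar>f u\<bar>)) f"
    unfolding hamming_lipschitz_def by blast
qed

section \<open>Cubes of sites\<close>

definition cube :: "'d::finite site \<Rightarrow> nat \<Rightarrow> 'd site set" where
  "cube c R = {k. \<forall>j. \<bar>k $ j - c $ j\<bar> \<le> int R}"

text \<open>The growth in \<open>R\<close> is polynomial, with the dimension as exponent; this is
  what the geometric contraction has to beat.\<close>

lemma
  fixes c :: "'d::finite site"
  shows finite_cube: "finite (cube c R)" and card_cube_le: "card (cube c R) \<le> (2 * R + 1) ^ CARD('d)"
proof -
  let ?P = "PiE (UNIV :: 'd set) (\<lambda>j. {c $ j - int R .. c $ j + int R})"
  have sub: "cube c R \<subseteq> vec_lambda ` ?P"
  proof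
    fix k assume "k \<in> cube c R"
    then have "c $ j - int R \<le> k $ j \<and> k $ j \<le> c $ j + int R" for j
      unfolding cube_def mem_Collect_eq by (smt (verit))
    then have "vec_nth k \<in> ?P" by (simp add: PiE_iff)
    then have "vec_lambda (vec_nth k) \<in> vec_lambda ` ?P" by (rule imageI)
    then show "k \<in> vec_lambda ` ?P" by simp
  qed
  have fin: "finite ?P" by (rule finite_PiE) auto
  then show "finite (cube c R)" using sub by (meson finite_imageI finite_subset)
  have "card (cube c R) \<le> card ?P"
    using sub fin by (meson card_image_le card_mono finite_imageI order_trans)
  also have "\<dots> = (\<Prod>j\<in>(UNIV :: 'd set). card {c $ j - int R .. c $ j + int R})"
    by (rule card_PiE) simp
  also have "\<dots> = (\<Prod>j\<in>(UNIV :: 'd set). 2 * R + 1)"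
    by (rule prod.cong) (simp_all add: nat_eq_iff2)
  also have "\<dots> = (2 * R + 1) ^ CARD('d)" by (rule prod_constant)
  finally show "card (cube c R) \<le> (2 * R + 1) ^ CARD('d)" .
qed

lemma finite_subset_cube:
  fixes K :: "'d::finite site set"
  assumes "finite K"
  obtains R where "K \<subseteq> cube 0 R"
proof
  let ?S = "(\<lambda>(k, j). nat \<bar>k $ j\<bar>) ` (K \<times> (UNIV :: 'd set))"
  show "K \<subseteq> cube 0 (Max (insert 0 ?S))"
  proof
    fix k assume k: "k \<in> K"
    have "nat \<bar>k $ j\<bar> \<le> Max (insert 0 ?S)" for j
      by (rule Max_ge) (use k assms in auto)
    then show "k \<in> cube 0 (Max (insert 0 ?S))" by (auto simp: cube_def nat_le_iff)
  qed
qed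

lemma cube_disjoint: "c \<notin> cube 0 (2 * R) \<Longrightarrow> cube 0 R \<inter> cube c R = {}"
proof (rule ccontr)
  assume c: "c \<notin> cube 0 (2 * R)" and "cube 0 R \<inter> cube c R \<noteq> {}"
  then obtain k where k: "k \<in> cube 0 R" "k \<in> cube c R" by blast
  obtain j where "\<bar>c $ j\<bar> > 2 * int R"
    using c by (auto simp: cube_def not_le)
  moreover have "\<bar>k $ j\<bar> \<le> int R" "\<bar>k $ j - c $ j\<bar> \<le> int R"
    using k by (simp_all add: cube_def)
  ultimately show False by linarith
qed

text \<open>
  A discrepancy in component \<open>i\<close> either stays there or, if a particle \<open>j\<close> is annihilated in only one
  of the two symbols, moves to \<open>j\<close>; it is never duplicated.
\<close>

lemma annihilation_rule_flip:
  assumes "annihilation_rule h"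
  shows "h (a(i := \<not> a i)) = h a \<or> (\<exists>j. h (a(i := \<not> a i)) = (h a)(j := \<not> h a j))"
proof -
  \<comment> \<open>Hamming distance at most 1. Each elementary rule preserves this relation, so it
    passes through the whole composition.\<close>
  define near where "near a b \<longleftrightarrow> b = a \<or> (\<exists>j. b = a(j := \<not> a j))" for a b :: "'a symbol"
  have elem: "near (elem_annihilation i j a) (elem_annihilation i j b)" if ij: "i \<noteq> j" and ab: "near a b" for i j and a b :: "'a symbol"
  proof -
    consider "b = a" | k where "b = a(k := \<not> a k)" using ab unfolding near_def by blast
    then show ?thesis
    proof cases
      case 1
      then show ?thesis by (simp add: near_def)
    next
      case 2
      consider "k = i" | "k = j" | "k \<noteq> i" "k \<noteq> j" by blast
      then show ?thesis
      proof cases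
        case 1
        have "\<exists>l. elem_annihilation i j b = (elem_annihilation i j a)(l := \<not> elem_annihilation i j a l)"
          \<comment> \<open>If \<open>j\<close> is present, exactly one of the two symbols holds
            both particles and loses them: the discrepancy moves from \<open>i\<close> to
            \<open>j\<close>. If \<open>j\<close> is absent, nothing is annihilated and the
            discrepancy stays at \<open>i\<close>.\<close>
          by (rule exI[of _ "if a j then j else i"])
             (use 1 2 ij in \<open>auto simp: elem_annihilation_def fun_eq_iff\<close>)
        then show ?thesis unfolding near_def by blast
      next
        case j: 2
        have "\<exists>l. elem_annihilation i j b = (elem_annihilation i j a)(l := \<not> elem_annihilation i j a l)"
          by (rule exI[of _ "if a i then i else j"])
             (use 2 j ij in \<open>auto simp: elem_annihilation_def fun_eq_iff\<close>)
        then show ?thesis unfolding near_def by blast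
      next
        case 3
        have "elem_annihilation i j b = (elem_annihilation i j a)(k := \<not> elem_annihilation i j a k)"
          using 2 3 by (auto simp: elem_annihilation_def fun_eq_iff)
        then show ?thesis unfolding near_def by blast
      qed
    qed
  qed
  have fold: "near (fold (\<lambda>(i, j). elem_annihilation i j) ps a) (fold (\<lambda>(i, j). elem_annihilation i j) ps b)"
    if "\<forall>(i, j)\<in>set ps. i \<noteq> j" "near a b" for ps and a b :: "'a symbol"
    using that
  proof (induction ps arbitrary: a b)
    case (Cons p ps)
    then show ?case by (cases p) (auto intro!: Cons.IH elem)
  qed simp
  obtain ps where "\<forall>(i, j)\<in>set ps. i \<noteq> j" "h = fold (\<lambda>(i, j). elem_annihilation i j) ps"
    using assms unfolding annihilation_rule_def by blast
  with fold[of ps a "a(i := \<not> a i)"] have "near (h a) (h (a(i := \<not> a i)))"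
    by (auto simp: near_def)
  then show ?thesis unfolding near_def by blast
qed

section \<open>Expectations over independent Bernoulli variables\<close>

lemma expectation_Pi_pmf_insert_bernoulli:
  fixes g :: "('c \<Rightarrow> bool) \<Rightarrow> real"
  assumes D: "finite D" "c \<notin> D" and q: "0 \<le> q c" "q c \<le> 1"
  shows "measure_pmf.expectation (Pi_pmf (insert c D) dflt (\<lambda>c. bernoulli_pmf (q c))) g
       = measure_pmf.expectation (Pi_pmf D dflt (\<lambda>c. bernoulli_pmf (q c)))
           (\<lambda>y. q c * g (y(c := True)) + (1 - q c) * g (y(c := False)))"
proof -
  let ?P = "Pi_pmf D dflt (\<lambda>c. bernoulli_pmf (q c))"
  have fin: "finite (set_pmf ?P)"
    by (rule finite_subset[OF set_Pi_pmf_subset'[OF D(1)]]) (rule finite_PiE_dflt, use D in auto)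
  \<comment> \<open>Independent draws commute, so coordinate \<open>c\<close> may be drawn last;
    averaging over its two values gives the integrand on the right-hand side.\<close>
  have "Pi_pmf (insert c D) dflt (\<lambda>c. bernoulli_pmf (q c))
      = bind_pmf ?P (\<lambda>y. map_pmf (\<lambda>b. y(c := b)) (bernoulli_pmf (q c)))"
    unfolding Pi_pmf_insert[OF D] pair_pmf_def map_bind_pmf
    by (subst bind_commute_pmf) (simp add: map_pmf_def bind_assoc_pmf bind_return_pmf)
  then have "measure_pmf.expectation (Pi_pmf (insert c D) dflt (\<lambda>c. bernoulli_pmf (q c))) g
      = measure_pmf.expectation ?P (\<lambda>y. measure_pmf.expectation (map_pmf (\<lambda>b. y(c := b)) (bernoulli_pmf (q c))) g)"
    by (simp add: pmf_expectation_bind[OF fin] integral_measure_pmf[OF fin])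
  also have "\<dots> = measure_pmf.expectation ?P (\<lambda>y. q c * g (y(c := True)) + (1 - q c) * g (y(c := False)))"
    using q by (intro Bochner_Integration.integral_cong) auto
  finally show ?thesis .
qed

text \<open>Conditionally on the other coordinates, whose law is the same in both products, the two
  expectations differ by \<open>q' d - q d\<close> times the effect on \<open>g\<close> of switching
  coordinate \<open>d\<close>.\<close>

lemma expectation_Pi_pmf_bernoulli_diff:
  fixes g :: "('c \<Rightarrow> bool) \<Rightarrow> real"
  assumes D: "finite D"
    and q: "\<And>c. q c \<in> {0..1}" and q': "\<And>c. q' c \<in> {0..1}"
    and eq: "\<And>c. c \<noteq> d \<Longrightarrow> q' c = q c"
    and g: "\<And>y. \<bar>g (y(d := True)) - g (y(d := False))\<bar> \<le> L"
  shows "\<bar>measure_pmf.expectation (Pi_pmf D dflt (\<lambda>c. bernoulli_pmf (q' c))) g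
        - measure_pmf.expectation (Pi_pmf D dflt (\<lambda>c. bernoulli_pmf (q c))) g\<bar> \<le> \<bar>q' d - q d\<bar> * L"
proof (cases "d \<in> D")
  case False
  have "Pi_pmf D dflt (\<lambda>c. bernoulli_pmf (q' c)) = Pi_pmf D dflt (\<lambda>c. bernoulli_pmf (q c))"
    by (rule Pi_pmf_cong) (use eq False in \<open>metis+\<close>)
  moreover have "0 \<le> L" using g abs_ge_zero order_trans by blast
  ultimately show ?thesis by simp
next
  case True
  define E where "E = D - {d}"
  have E: "finite E" "d \<notin> E" "D = insert d E" using True D by (auto simp: E_def)
  let ?P = "Pi_pmf E dflt (\<lambda>c. bernoulli_pmf (q c))"
  have fin: "finite (set_pmf ?P)"
    by (rule finite_subset[OF set_Pi_pmf_subset'[OF E(1)]]) (rule finite_PiE_dflt, use E in auto)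
  have int: "integrable ?P f" for f :: "_ \<Rightarrow> real" by (rule integrable_measure_pmf_finite[OF fin])
  have P: "Pi_pmf E dflt (\<lambda>c. bernoulli_pmf (q' c)) = ?P"
    by (rule Pi_pmf_cong) (use eq E in \<open>metis+\<close>)
  have "measure_pmf.expectation (Pi_pmf D dflt (\<lambda>c. bernoulli_pmf (q' c))) g
        - measure_pmf.expectation (Pi_pmf D dflt (\<lambda>c. bernoulli_pmf (q c))) g
      = measure_pmf.expectation ?P (\<lambda>y. (q' d - q d) * (g (y(d := True)) - g (y(d := False))))"
    unfolding E(3) using q[of d] q'[of d] E
    by (simp add: expectation_Pi_pmf_insert_bernoulli P Bochner_Integration.integral_diff[OF int int, symmetric] algebra_simps
        del: Bochner_Integration.integral_diff Bochner_Integration.integral_add)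
  also have "\<bar>\<dots>\<bar> \<le> measure_pmf.expectation ?P (\<lambda>y. \<bar>(q' d - q d) * (g (y(d := True)) - g (y(d := False)))\<bar>)"
    by (rule integral_abs_bound)
  also have "\<dots> \<le> measure_pmf.expectation ?P (\<lambda>y. \<bar>q' d - q d\<bar> * L)"
    by (rule integral_mono[OF int int]) (auto simp: abs_mult intro!: mult_left_mono g)
  finally show ?thesis by simp
qed


section \<open>Contraction by the transition operator\<close>

text \<open>\<open>F\<close> is given in coordinates, and \<open>\<Phi>\<close> may be any kernel
  with the prescribed cylinder probabilities, so everything below rests on those probabilities and
  on measurability.\<close>

locale noisy_gliders =
  fixes F :: "('d::finite, 'n::finite) config \<Rightarrow> ('d, 'n) config"
    and v :: "'n \<Rightarrow> 'd site" and h :: "'n symbol \<Rightarrow> 'n symbol"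
    and \<beta> \<delta> :: "'n \<Rightarrow> real" and \<Phi> :: "('d, 'n) kernel"
  assumes F_eq: "F x k = h (\<lambda>i. x (k + v i) i)"
    and h: "annihilation_rule h"
    and \<beta>: "0 < \<beta> i" "\<beta> i < 1" and \<delta>: "0 < \<delta> i" "\<delta> i < 1"
    and noisy: "is_noisy_version F (birth_death_noise \<beta> \<delta>) \<Phi>"
begin

text \<open>\<open>1 - \<beta> i - \<delta> i\<close> is the second eigenvalue of the two-state
  matrix of type \<open>i\<close>, and also the difference between the probabilities of finding a
  particle after the noise when one was present and when none was. As there are finitely many types,
  the maximum is still below 1.\<close>

definition contraction :: real where
  "contraction = Max (range (\<lambda>i. \<bar>1 - \<beta> i - \<delta> i\<bar>))"

lemma contraction_ge: "\<bar>1 - \<beta> i - \<delta> i\<bar> \<le> contraction"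
  unfolding contraction_def by (rule Max_ge) auto

lemma contraction_nonneg: "0 \<le> contraction"
  using contraction_ge abs_ge_zero order_trans by blast

lemma contraction_less_1: "contraction < 1"
  unfolding contraction_def using \<beta> \<delta> by (subst Max_less_iff) (auto simp: abs_less_iff algebra_simps, (smt (verit))+)

text \<open>A common bound for the coordinates of all velocities, hence for the speed at which
  dependence spreads.\<close>

definition radius :: nat where
  "radius = (SOME r. range v \<subseteq> cube 0 r)"

lemma radius: "\<bar>v i $ j\<bar> \<le> int radius"
proof -
  have "\<exists>r. range v \<subseteq> cube 0 r" using finite_subset_cube[of "range v"] by auto
  then have "range v \<subseteq> cube 0 radius" unfolding radius_def by (rule someI_ex)
  then show ?thesis unfolding cube_def by auto
qed

lemma cube_radius:
  assumes "k \<in> cube c R"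
  shows "k + v i \<in> cube c (R + radius)"
proof -
  have "\<bar>(k + v i) $ j - c $ j\<bar> \<le> int (R + radius)" for j
  proof -
    have "\<bar>k $ j - c $ j\<bar> \<le> int R" using assms by (simp add: cube_def)
    then show ?thesis using radius[of i j] by simp
  qed
  then show ?thesis by (simp add: cube_def)
qed

text \<open>Component \<open>i\<close> of site \<open>k\<close> is read at one site only, namely
  \<open>k - v i\<close>. There the rule \<open>h\<close> receives two symbols differing in one
  component, and \<open>annihilation_rule_flip\<close> applies; all other sites are
  unaffected.\<close>

lemma F_flip: "F (flip k i x) = F x \<or> (\<exists>l j. F (flip k i x) = flip l j (F x))"
proof -
  define l where "l = k - v i"
  define a where "a = (\<lambda>j. x (l + v j) j)"
  have other: "F (flip k i x) m = F x m" if "m \<noteq> l" for m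
  proof -
    have "(\<lambda>j. flip k i x (m + v j) j) = (\<lambda>j. x (m + v j) j)"
      using that by (auto simp: flip_def l_def fun_eq_iff)
    then show ?thesis by (simp add: F_eq)
  qed
  have "(\<lambda>j. flip k i x (l + v j) j) = a(i := \<not> a i)"
    by (auto simp: flip_def a_def l_def fun_eq_iff)
  then have l: "F (flip k i x) l = h (a(i := \<not> a i))" "F x l = h a"
    by (simp_all add: F_eq a_def)
  from annihilation_rule_flip[OF h, of a i] show ?thesis
  proof
    assume "h (a(i := \<not> a i)) = h a"
    then have "F (flip k i x) m = F x m" for m using other l by (cases "m = l") auto
    then show ?thesis by blast
  next
    assume "\<exists>j. h (a(i := \<not> a i)) = (h a)(j := \<not> h a j)"
    then obtain j where "h (a(i := \<not> a i)) = (h a)(j := \<not> h a j)" ..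
    then have "F (flip k i x) m = flip l j (F x) m" for m
      using other l by (cases "m = l") (auto simp: flip_def)
    then show ?thesis by blast
  qed
qed

section \<open>The transition operator on local functions\<close>

lemma \<Phi>_measurable: "\<Phi> \<in> borel \<rightarrow>\<^sub>M prob_algebra borel"
  using noisy unfolding is_noisy_version_def by blast

lemma prob_space_\<Phi>: "prob_space (\<Phi> x)" and sets_\<Phi>: "sets (\<Phi> x) = sets borel"
  using measurable_space[OF \<Phi>_measurable, of x] by (auto simp: space_prob_algebra)

lemma measure_\<Phi>_cylinder:
  "finite K \<Longrightarrow> measure (\<Phi> x) (cylinder K u) = (\<Prod>k\<in>K. birth_death_noise \<beta> \<delta> (F x k) (u k))"
  using noisy unfolding is_noisy_version_def by blast

definition T :: "(('d, 'n) config \<Rightarrow> real) \<Rightarrow> ('d, 'n) config \<Rightarrow> real" where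
  "T f x = (\<integral>y. f y \<partial>\<Phi> x)"

text \<open>Displays \<open>T f x\<close> as a function of the symbols \<open>F x k\<close> with
  \<open>k\<close> in \<open>K\<close>. Hence dependence spreads only as far as \<open>F\<close>
  reads, and a flip that leaves \<open>F x\<close> unchanged leaves \<open>T f x\<close>
  unchanged.\<close>

lemma T_eq_sum:
  assumes "finite K" "depends_on K f"
  shows "T f x = (\<Sum>u\<in>patterns K. f u * (\<Prod>k\<in>K. birth_death_noise \<beta> \<delta> (F x k) (u k)))"
  unfolding T_def integral_depends_on[OF assms prob_space_\<Phi> sets_\<Phi>]
  by (simp add: measure_\<Phi>_cylinder assms)

lemma depends_on_T:
  assumes "depends_on (cube c R) f"
  shows "depends_on (cube c (R + radius)) (T f)"
proof -
  have "T f x = T f y" if "\<forall>k\<in>cube c (R + radius). x k = y k" for x y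
  proof -
    have "F x k = F y k" if "k \<in> cube c R" for k
      using \<open>\<forall>k\<in>_. x k = y k\<close> cube_radius[OF that] by (simp add: F_eq)
    then show ?thesis
      by (simp add: T_eq_sum[OF finite_cube assms])
  qed
  then show ?thesis unfolding depends_on_def by blast
qed

text \<open>The noise acts independently on single components, so the new symbols on
  \<open>K\<close> are independent bits indexed by pairs of site and type. This isolates the one
  parameter that changes when \<open>F x\<close> is flipped.\<close>

lemma T_eq_expectation:
  assumes K: "finite K" and f: "depends_on K f"
  shows "T f x = measure_pmf.expectation
      (Pi_pmf (K \<times> UNIV) False (\<lambda>c. bernoulli_pmf (bd_matrix (\<beta> (snd c)) (\<delta> (snd c)) (F x (fst c) (snd c)) True)))
      (\<lambda>y. f (curry y))"
proof -
  let ?C = "K \<times> (UNIV :: 'n set)"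
  let ?q = "\<lambda>c. bd_matrix (\<beta> (snd c)) (\<delta> (snd c)) (F x (fst c) (snd c))"
  let ?P = "Pi_pmf ?C False (\<lambda>c. bernoulli_pmf (?q c True))"
  let ?A = "PiE_dflt ?C False (\<lambda>_. UNIV)"
  have fin: "finite ?C" using K by simp
  have bern: "pmf (bernoulli_pmf (?q c True)) b = ?q c b" for c b
    using \<beta>[of "snd c"] \<delta>[of "snd c"]
    by (cases b) (auto simp: bd_matrix_def)
  \<comment> \<open>The default \<open>False\<close> off \<open>K\<close> matches the empty symbols
    chosen in \<open>patterns\<close>, so currying is a bijection of representatives.\<close>
  have bij: "bij_betw curry ?A (patterns K)"
    by (rule bij_betwI[where g = case_prod])
       (auto simp: PiE_dflt_def patterns_def fun_eq_iff split: prod.splits)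
  have "measure_pmf.expectation ?P (\<lambda>y. f (curry y)) = (\<Sum>y\<in>?A. f (curry y) * pmf ?P y)"
  proof (rule integral_measure_pmf_real)
    show "finite ?A" by (rule finite_PiE_dflt) (use fin in auto)
    show "y \<in> ?A" if "y \<in> set_pmf ?P" for y
      using set_Pi_pmf_subset'[OF fin, of False "\<lambda>c. bernoulli_pmf (?q c True)"] that
      by (auto simp: PiE_dflt_def)
  qed
  also have "\<dots> = (\<Sum>y\<in>?A. f (curry y) * (\<Prod>k\<in>K. birth_death_noise \<beta> \<delta> (F x k) (curry y k)))"
  proof (rule sum.cong[OF refl])
    fix y assume "y \<in> ?A"
    then have "pmf ?P y = (\<Prod>c\<in>?C. ?q c (y c))"
      by (subst pmf_Pi'[OF fin]) (auto simp: bern PiE_dflt_def)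
    also have "\<dots> = (\<Prod>k\<in>K. birth_death_noise \<beta> \<delta> (F x k) (curry y k))"
      unfolding birth_death_noise_def by (simp add: prod.cartesian_product case_prod_unfold)
    finally show "f (curry y) * pmf ?P y = f (curry y) * (\<Prod>k\<in>K. birth_death_noise \<beta> \<delta> (F x k) (curry y k))"
      by simp
  qed
  also have "\<dots> = (\<Sum>u\<in>patterns K. f u * (\<Prod>k\<in>K. birth_death_noise \<beta> \<delta> (F x k) (u k)))"
    by (rule sum.reindex_bij_betw[OF bij])
  finally show ?thesis by (simp add: T_eq_sum[OF K f])
qed

text \<open>By \<open>F_flip\<close> a flip of the input changes at most one Bernoulli parameter,
  and changes it by \<bar>\<open>1 - \<beta> j - \<delta> j\<close>\<bar>; toggling the
  corresponding output bit changes \<open>f\<close> by at most \<open>L\<close>.\<close>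

lemma hamming_lipschitz_T:
  assumes K: "finite K" and f: "depends_on K f" and L: "hamming_lipschitz L f"
  shows "hamming_lipschitz (contraction * L) (T f)"
  unfolding hamming_lipschitz_def
proof (intro allI)
  fix k i x
  have L0: "0 \<le> L" using L unfolding hamming_lipschitz_def by (meson abs_ge_zero order_trans)
  from F_flip[of k i x] show "\<bar>T f (flip k i x) - T f x\<bar> \<le> contraction * L"
  proof (elim disjE exE)
    assume "F (flip k i x) = F x"
    then show ?thesis using L0 contraction_nonneg by (simp add: T_eq_sum[OF K f])
  next
    fix l j assume lj: "F (flip k i x) = flip l j (F x)"
    have "\<bar>T f (flip k i x) - T f x\<bar>
        \<le> \<bar>bd_matrix (\<beta> j) (\<delta> j) (\<not> F x l j) True - bd_matrix (\<beta> j) (\<delta> j) (F x l j) True\<bar> * L"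
      unfolding T_eq_expectation[OF K f] lj
    proof (rule order_trans[OF expectation_Pi_pmf_bernoulli_diff[where d = "(l, j)" and L = L]])
      fix y :: "'d site \<times> 'n \<Rightarrow> bool"
      have "curry (y((l, j) := True)) = flip l j (curry (y((l, j) := False)))"
        by (auto simp: flip_def fun_eq_iff)
      then show "\<bar>f (curry (y((l, j) := True))) - f (curry (y((l, j) := False)))\<bar> \<le> L"
        using L unfolding hamming_lipschitz_def by simp
    qed (use K \<beta> \<delta> in \<open>auto simp: bd_matrix_def flip_def less_imp_le\<close>)
    also have "\<dots> \<le> contraction * L"
    proof (rule mult_right_mono[OF _ L0])
      show "\<bar>bd_matrix (\<beta> j) (\<delta> j) (\<not> F x l j) True - bd_matrix (\<beta> j) (\<delta> j) (F x l j) True\<bar> \<le> contraction"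
        using contraction_ge[of j] by (auto simp: bd_matrix_def abs_le_iff)
    qed
    finally show ?thesis .
  qed
qed

end


section \<open>Uniform convergence of the iterates\<close>

text \<open>With \<open>s\<close> the \<open>n\<close>-th root of \<open>c\<close>, each term is the
  \<open>n\<close>-th power of \<open>s ^ t\<close> times an affine function of \<open>t\<close>, so
  it suffices that \<open>t * s ^ t\<close> tends to 0.\<close>

lemma power_poly_tendsto_0:
  fixes c :: real
  assumes c: "0 \<le> c" "c < 1" and n: "0 < n"
  shows "(\<lambda>t. c ^ t * real ((2 * (R + t * r) + 1) ^ n)) \<longlonglongrightarrow> 0"
proof -
  define s where "s = root n c"
  have s: "0 \<le> s" "s < 1" "s ^ n = c"
    using assms by (auto simp: s_def)
  have "(\<lambda>t. real (2 * R + 1) * s ^ t + real (2 * r) * (real t * s ^ t)) \<longlonglongrightarrow> real (2 * R + 1) * 0 + real (2 * r) * 0"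
    by (intro tendsto_intros LIMSEQ_power_zero powser_times_n_limit_0) (use s in auto)
  then have "(\<lambda>t. (real (2 * R + 1) * s ^ t + real (2 * r) * (real t * s ^ t)) ^ n) \<longlonglongrightarrow> 0"
    using tendsto_power[of _ "real (2 * R + 1) * 0 + real (2 * r) * 0" _ n] n
    by (simp only: mult_zero_right add_0 zero_power)
  moreover have "(\<lambda>t. (real (2 * R + 1) * s ^ t + real (2 * r) * (real t * s ^ t)) ^ n)
      = (\<lambda>t. c ^ t * real ((2 * (R + t * r) + 1) ^ n))"
  proof
    fix t
    have "real (2 * R + 1) * s ^ t + real (2 * r) * (real t * s ^ t) = s ^ t * real (2 * (R + t * r) + 1)"
      by (simp add: algebra_simps)
    then show "(real (2 * R + 1) * s ^ t + real (2 * r) * (real t * s ^ t)) ^ n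
        = c ^ t * real ((2 * (R + t * r) + 1) ^ n)"
      by (simp only: power_mult_distrib power_mult[symmetric] mult.commute[of t n] s(3)[symmetric] of_nat_power)
  qed
  ultimately show ?thesis by simp
qed

lemma (in prob_space) integral_near_const:
  fixes g :: "'a \<Rightarrow> real"
  assumes g: "integrable M g" and near: "\<And>y. \<bar>g y - a\<bar> \<le> B"
  shows "\<bar>(\<integral>y. g y \<partial>M) - a\<bar> \<le> B"
proof -
  have "(\<integral>y. g y \<partial>M) - a = (\<integral>y. g y - a \<partial>M)"
    using g by (simp add: prob_space)
  also have "\<bar>\<dots>\<bar> \<le> (\<integral>y. \<bar>g y - a\<bar> \<partial>M)" by (rule integral_abs_bound)
  also have "\<dots> \<le> (\<integral>y. B \<partial>M)"
    by (rule integral_mono) (use g near in auto)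
  finally show ?thesis by (simp add: prob_space)
qed

text \<open>Both functions are finite combinations of cylinder indicators, so the product formula
  for cylinders extends bilinearly.\<close>

lemma integral_mult_depends_on:
  assumes K: "finite K" "depends_on K f" and L: "finite L" "depends_on L g"
    and M: "prob_space M" "sets M = sets borel"
    and indep: "\<And>u w. measure M (cylinder K u \<inter> cylinder L w) = measure M (cylinder K u) * measure M (cylinder L w)"
  shows "(\<integral>x. f x * g x \<partial>M) = (\<integral>x. f x \<partial>M) * (\<integral>x. g x \<partial>M)"
proof -
  interpret prob_space M by fact
  have cyl: "cylinder K u \<inter> cylinder L w \<in> sets M" for u w
    using cylinder_sets[OF K(1), of u] cylinder_sets[OF L(1), of w] M by auto
  have int: "integrable M (indicator (cylinder K u \<inter> cylinder L w) :: _ \<Rightarrow> real)" for u w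
    by (rule integrable_real_indicator[OF cyl]) (simp add: emeasure_eq_measure)
  have "f x * g x = (\<Sum>u\<in>patterns K. \<Sum>w\<in>patterns L.
      (f u * g w) * indicator (cylinder K u \<inter> cylinder L w) x)" for x
  proof -
    have "f x * g x = (\<Sum>u\<in>patterns K. f u * indicator (cylinder K u) x) * (\<Sum>w\<in>patterns L. g w * indicator (cylinder L w) x)"
      by (rule arg_cong2[where f = times]) (rule depends_on_eq_sum_indicator[OF K], rule depends_on_eq_sum_indicator[OF L])
    then show ?thesis by (simp add: sum_product indicator_inter_arith ac_simps)
  qed
  then have "(\<integral>x. f x * g x \<partial>M) = (\<integral>x. (\<Sum>u\<in>patterns K. \<Sum>w\<in>patterns L.
      (f u * g w) * indicator (cylinder K u \<inter> cylinder L w) x) \<partial>M)"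
    by (rule Bochner_Integration.integral_cong[OF refl])
  also have "\<dots> = (\<Sum>u\<in>patterns K. \<Sum>w\<in>patterns L.
      (\<integral>x. (f u * g w) * indicator (cylinder K u \<inter> cylinder L w) x \<partial>M))"
    by (subst Bochner_Integration.integral_sum)
       (intro Bochner_Integration.integrable_sum integrable_mult_right int sum.cong[OF refl]
         Bochner_Integration.integral_sum)+
  also have "\<dots> = (\<Sum>u\<in>patterns K. \<Sum>w\<in>patterns L.
      (f u * measure M (cylinder K u)) * (g w * measure M (cylinder L w)))"
    using cyl[THEN sets.sets_into_space]
    by (intro sum.cong refl) (simp add: Int_absorb2 indep)
  also have "\<dots> = (\<integral>x. f x \<partial>M) * (\<integral>x. g x \<partial>M)"
    by (simp add: integral_depends_on[OF K M] integral_depends_on[OF L M] sum_product)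
  finally show ?thesis .
qed

section \<open>Shifts of configurations and of local functions\<close>

lemma vimage_shift_cylinder:
  "shift k -` cylinder K u = cylinder ((+) k ` K) (\<lambda>j. u (j - k))"
  unfolding shift_def cylinder_def by auto

lemma measurable_shift: "shift k \<in> borel \<rightarrow>\<^sub>M (borel :: ('d::finite, 'n::finite) config measure)"
  unfolding measurable_cong_sets[OF sets_borel_config sets_borel_config] shift_def
  by (rule measurable_PiM_single') (auto intro!: measurable_component_singleton)

lemma depends_on_shift:
  fixes f :: "('d::finite, 'n::finite) config \<Rightarrow> real"
  assumes "depends_on (cube c R) f"
  shows "depends_on (cube (c + k) R) (\<lambda>x. f (shift k x))"
  unfolding depends_on_def
proof (intro allI impI)
  fix x y :: "('d, 'n) config" assume eq: "\<forall>m\<in>cube (c + k) R. x m = y m"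
  have "k + m \<in> cube (c + k) R" if "m \<in> cube c R" for m
    using that by (simp add: cube_def)
  then show "f (shift k x) = f (shift k y)"
    using eq by (intro depends_onD[OF assms]) (simp add: shift_def)
qed

context noisy_gliders
begin

lemma depends_on_T_pow:
  "depends_on (cube c R) f \<Longrightarrow> depends_on (cube c (R + t * radius)) ((T ^^ t) f)"
proof (induction t)
  case (Suc t)
  then show ?case
    using depends_on_T[of c "R + t * radius" "(T ^^ t) f"] by (simp add: ac_simps)
qed simp

lemma finite_depends_on_T_pow:
  assumes "finite K" "depends_on K f"
  obtains L where "finite L" "depends_on L ((T ^^ t) f)"
  using assms finite_subset_cube depends_on_mono depends_on_T_pow finite_cube by metis

lemma hamming_lipschitz_T_pow:
  assumes "depends_on (cube c R) f" "hamming_lipschitz L f"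
  shows "hamming_lipschitz (contraction ^ t * L) ((T ^^ t) f)"
proof (induction t)
  case (Suc t)
  show ?case
    using hamming_lipschitz_T[OF finite_cube depends_on_T_pow[OF assms(1)] Suc] by (simp add: mult.assoc)
qed (use assms in simp)

text \<open>The bound is the Lipschitz constant \<open>contraction ^ t * L\<close> times the number
  of components in the cube of radius \<open>R + t * radius\<close>: geometric decay against
  polynomial growth.\<close>

lemma T_pow_oscillation:
  assumes f: "depends_on (cube c R) f"
  obtains b where "b \<longlonglongrightarrow> 0" "\<And>t x y. \<bar>(T ^^ t) f x - (T ^^ t) f y\<bar> \<le> b t"
proof -
  obtain L where L: "hamming_lipschitz L f"
    using depends_on_hamming_lipschitz[OF finite_cube f] by blast
  have L0: "0 \<le> L" using L unfolding hamming_lipschitz_def by (meson abs_ge_zero order_trans)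
  define b where "b t = L * CARD('n) * (contraction ^ t * real ((2 * (R + t * radius) + 1) ^ CARD('d)))" for t
  have "b \<longlonglongrightarrow> L * CARD('n) * 0"
    unfolding b_def
    by (intro tendsto_mult tendsto_const power_poly_tendsto_0 contraction_nonneg contraction_less_1) simp
  moreover have "\<bar>(T ^^ t) f x - (T ^^ t) f y\<bar> \<le> b t" for t x y
  proof -
    have "\<bar>(T ^^ t) f x - (T ^^ t) f y\<bar>
        \<le> (contraction ^ t * L) * (card (cube c (R + t * radius)) * CARD('n))"
      by (rule depends_on_oscillation[OF hamming_lipschitz_T_pow[OF f L] depends_on_T_pow[OF f] finite_cube])
    also have "\<dots> \<le> (contraction ^ t * L) * ((2 * (R + t * radius) + 1) ^ CARD('d) * CARD('n))"
      using L0 contraction_nonneg card_cube_le[of c "R + t * radius"]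
      by (intro mult_left_mono of_nat_mono mult_right_mono) auto
    also have "\<dots> = b t" by (simp add: b_def ac_simps)
    finally show ?thesis .
  qed
  ultimately show ?thesis using that[of b] by simp
qed

section \<open>Duality between the kernel and the transition operator\<close>

lemma
  assumes M: "prob_space M" "sets M = sets borel"
  shows prob_space_bind_\<Phi>: "prob_space (M \<bind> \<Phi>)" and sets_bind_\<Phi>: "sets (M \<bind> \<Phi>) = sets borel"
    and integral_bind_\<Phi>:
      "finite K \<Longrightarrow> depends_on K f \<Longrightarrow> (\<integral>x. f x \<partial>(M \<bind> \<Phi>)) = (\<integral>x. T f x \<partial>M)"
proof -
  have sp: "M \<in> space (prob_algebra borel)" using M by (simp add: space_prob_algebra)
  show "prob_space (M \<bind> \<Phi>)" by (rule prob_space_bind'[OF sp \<Phi>_measurable])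
  show "sets (M \<bind> \<Phi>) = sets borel" by (rule sets_bind'[OF sp \<Phi>_measurable])
  show "(\<integral>x. f x \<partial>(M \<bind> \<Phi>)) = (\<integral>x. T f x \<partial>M)" if f: "finite K" "depends_on K f"
    unfolding T_def
  proof (rule integral_bind[where K = borel and B' = 1])
    show "f \<in> borel_measurable borel" by (rule borel_measurable_depends_on[OF f])
    show "\<bar>f x\<bar> \<le> (\<Sum>u\<in>patterns K. \<bar>f u\<bar>)" for x by (rule depends_on_bounded[OF f])
    show "\<Phi> \<in> M \<rightarrow>\<^sub>M subprob_algebra borel"
      using measurable_prob_algebraD[OF \<Phi>_measurable] M by (simp cong: measurable_cong_sets)
    show "finite_measure M" using M(1) by (rule prob_space.finite_measure)
    show "AE x in M. emeasure (\<Phi> x) (space (\<Phi> x)) \<le> ennreal 1"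
      using prob_space.emeasure_space_1[OF prob_space_\<Phi>] by simp
  qed
qed

lemma kernel_power_prob:
  "prob_space (kernel_power \<Phi> t x)" "sets (kernel_power \<Phi> t x) = sets borel"
proof (induction t)
  case 0
  { case 1 show ?case by (simp add: prob_space_return) }
  { case 2 show ?case by simp }
next
  case (Suc t)
  { case 1 show ?case using prob_space_bind_\<Phi>[OF Suc] by simp }
  { case 2 show ?case using sets_bind_\<Phi>[OF Suc] by simp }
qed

text \<open>The last transition is integrated out first, which replaces \<open>f\<close> by
  \<open>T f\<close>; the induction therefore keeps \<open>f\<close> and its set of sites
  arbitrary.\<close>

lemma integral_kernel_power:
  "finite K \<Longrightarrow> depends_on K f \<Longrightarrow> (\<integral>y. f y \<partial>kernel_power \<Phi> t x) = (T ^^ t) f x"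
proof (induction t arbitrary: K f)
  case 0
  then show ?case by (simp add: integral_return borel_measurable_depends_on)
next
  case (Suc t)
  obtain L where "finite L" "depends_on L ((T ^^ 1) f)"
    using finite_depends_on_T_pow[OF Suc.prems] by blast
  with Suc.IH[of L "T f"] Suc.prems show ?case
    by (simp add: integral_bind_\<Phi>[OF kernel_power_prob Suc.prems] funpow_swap1)
qed

text \<open>Vanishing oscillation alone would allow the nearly constant value to drift with
  \<open>t\<close>. The semigroup property rules this out by making the values at one fixed
  configuration a Cauchy sequence.\<close>

lemma T_pow_uniform_limit:
  assumes f: "depends_on (cube c R) f"
  obtains l b where "b \<longlonglongrightarrow> 0" "\<And>t x. \<bar>(T ^^ t) f x - l\<bar> \<le> b t"
proof -
  obtain b where b: "b \<longlonglongrightarrow> 0" and osc: "\<And>t x y. \<bar>(T ^^ t) f x - (T ^^ t) f y\<bar> \<le> b t"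
    by (rule T_pow_oscillation[OF f]) blast
  fix x0 :: "('d, 'n) config"
  define a where "a t = (T ^^ t) f x0" for t
  \<comment> \<open>\<open>a (s + t)\<close> is the average of \<open>(T ^^ t) f\<close> under the
    law after \<open>s\<close> steps from \<open>x0\<close>, and such an average is within the
    oscillation of every single value.\<close>
  have close: "\<bar>a (s + t) - a t\<bar> \<le> b t" for s t
  proof -
    interpret prob_space "kernel_power \<Phi> s x0" by (rule kernel_power_prob)
    have "a (s + t) = (\<integral>y. (T ^^ t) f y \<partial>kernel_power \<Phi> s x0)"
      unfolding a_def funpow_add comp_def
      by (rule integral_kernel_power[OF finite_cube depends_on_T_pow[OF f], symmetric])
    then show ?thesis unfolding a_def
      using integral_near_const[OF integrable_depends_on[OF finite_cube depends_on_T_pow[OF f] kernel_power_prob]]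
        osc by simp
  qed
  have "Cauchy a"
  proof (rule metric_CauchyI)
    fix e :: real assume "0 < e"
    then obtain N where N: "\<And>t. t \<ge> N \<Longrightarrow> \<bar>b t\<bar> < e / 2"
      using LIMSEQ_D[OF b, of "e / 2"] by auto
    have "\<bar>a m - a N\<bar> < e / 2" if "m \<ge> N" for m
      using close[of "m - N" N] N[of N] that by simp
    then show "\<exists>N. \<forall>m\<ge>N. \<forall>n\<ge>N. dist (a m) (a n) < e"
      unfolding dist_real_def by (intro exI[of _ N] allI impI) (smt (verit) field_sum_of_halves)
  qed
  then obtain l where l: "a \<longlonglongrightarrow> l" using Cauchy_convergent convergent_def by blast
  have "\<bar>a t - l\<bar> \<le> b t" for t
  proof -
    have "(\<lambda>s. \<bar>a (s + t) - a t\<bar>) \<longlonglongrightarrow> \<bar>l - a t\<bar>"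
      by (intro tendsto_intros LIMSEQ_ignore_initial_segment l)
    then have "\<bar>l - a t\<bar> \<le> b t" by (rule LIMSEQ_le_const2) (use close in blast)
    then show ?thesis by (simp add: abs_minus_commute)
  qed
  \<comment> \<open>One \<open>b t\<close> compares \<open>x\<close> with \<open>x0\<close>, the
    other compares the value at \<open>x0\<close> with the limit.\<close>
  then have "\<bar>(T ^^ t) f x - l\<bar> \<le> 2 * b t" for t x
    using osc[of t x x0] unfolding a_def by (smt (verit))
  moreover have "(\<lambda>t. 2 * b t) \<longlonglongrightarrow> 0" using tendsto_mult_right_zero[OF b] by simp
  ultimately show ?thesis using that by blast
qed

end


section \<open>Invariance, uniqueness and mixing\<close>

context noisy_gliders
begin

text \<open>The functional form of uniform ergodicity: \<open>b\<close> depends on \<open>t\<close>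
  but not on the configuration. Invariance, uniqueness and mixing are all derived from it.\<close>

definition ergodic_limit :: "('d, 'n) config measure \<Rightarrow> bool" where
  "ergodic_limit \<pi> \<longleftrightarrow> prob_space \<pi> \<and> sets \<pi> = sets borel \<and>
     (\<forall>K f. finite K \<longrightarrow> depends_on K f \<longrightarrow>
        (\<exists>b. b \<longlonglongrightarrow> 0 \<and> (\<forall>t x. \<bar>(T ^^ t) f x - (\<integral>y. f y \<partial>\<pi>)\<bar> \<le> b t)))"

lemma ergodic_limitD:
  assumes "ergodic_limit \<pi>"
  shows "prob_space \<pi>" "sets \<pi> = sets borel"
    and "finite K \<Longrightarrow> depends_on K f \<Longrightarrow>
      \<exists>b. b \<longlonglongrightarrow> 0 \<and> (\<forall>t x. \<bar>(T ^^ t) f x - (\<integral>y. f y \<partial>\<pi>)\<bar> \<le> b t)"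
  using assms unfolding ergodic_limit_def by blast+

text \<open>For indicators of cylinders, the iterates at \<open>x0\<close> are the cylinder
  probabilities of the chain started there, so these converge and define \<open>\<pi>\<close>. For a
  general local function the constant limit must be the \<open>\<pi>\<close>-integral, a finite
  combination of cylinder probabilities.\<close>

lemma ergodic_limit_exists: "\<exists>\<pi>. ergodic_limit \<pi>"
proof -
  fix x0 :: "('d, 'n) config"
  let ?\<mu> = "\<lambda>t. kernel_power \<Phi> t x0"
  have lim: "\<exists>l b. b \<longlonglongrightarrow> 0 \<and> (\<forall>t x. \<bar>(T ^^ t) f x - l\<bar> \<le> b t)"
    if f: "finite K" "depends_on K f" for K f
  proof -
    obtain R where "K \<subseteq> cube 0 R" using finite_subset_cube[OF f(1)] .
    then have "depends_on (cube 0 R) f" by (rule depends_on_mono[OF f(2)])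
    then show ?thesis by (rule T_pow_uniform_limit) blast
  qed
  have tends: "(\<lambda>t. (T ^^ t) f x0) \<longlonglongrightarrow> l"
    if b: "b \<longlonglongrightarrow> 0" and "\<forall>t x. \<bar>(T ^^ t) f x - l\<bar> \<le> b t" for f l b
  proof -
    have "(\<lambda>t. (T ^^ t) f x0 - l) \<longlonglongrightarrow> 0"
      by (rule Lim_null_comparison[OF _ b]) (use that in auto)
    then show ?thesis by (simp add: LIM_zero_iff)
  qed
  have conv: "convergent (\<lambda>t. measure (?\<mu> t) (cylinder K u))" if K: "finite K" for K u
  proof -
    have eq: "(T ^^ t) (indicator (cylinder K u)) x0 = measure (?\<mu> t) (cylinder K u)" for t
      using integral_kernel_power[OF K depends_on_indicator_cylinder[of K u], of t x0]
        sets_eq_imp_space_eq[OF kernel_power_prob(2)[of t x0]] by simp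
    obtain l b where "b \<longlonglongrightarrow> 0" "\<forall>t x. \<bar>(T ^^ t) (indicator (cylinder K u)) x - l\<bar> \<le> b t"
      using lim[OF K depends_on_indicator_cylinder] by blast
    from tends[OF this] show ?thesis unfolding eq convergent_def by blast
  qed
  obtain \<pi> where \<pi>: "prob_space \<pi>" "sets \<pi> = sets borel"
    and cyl: "\<And>K u. finite K \<Longrightarrow> (\<lambda>t. measure (?\<mu> t) (cylinder K u)) \<longlonglongrightarrow> measure \<pi> (cylinder K u)"
    by (rule limit_measure_exists[of ?\<mu>, OF kernel_power_prob conv]) blast+
  show ?thesis
    unfolding ergodic_limit_def
  proof (intro exI[of _ \<pi>] conjI allI impI \<pi>)
    fix K and f :: "('d, 'n) config \<Rightarrow> real"
    assume f: "finite K" "depends_on K f"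
    obtain l b where b: "b \<longlonglongrightarrow> 0" "\<forall>t x. \<bar>(T ^^ t) f x - l\<bar> \<le> b t"
      using lim[OF f] by blast
    have "(\<lambda>t. \<integral>y. f y \<partial>?\<mu> t) \<longlonglongrightarrow> (\<integral>y. f y \<partial>\<pi>)"
      unfolding integral_depends_on[OF f kernel_power_prob] integral_depends_on[OF f \<pi>]
      by (intro tendsto_sum tendsto_mult tendsto_const cyl f)
    then have "(\<lambda>t. (T ^^ t) f x0) \<longlonglongrightarrow> (\<integral>y. f y \<partial>\<pi>)"
      by (simp only: integral_kernel_power[OF f])
    then have "l = (\<integral>y. f y \<partial>\<pi>)" using tends[OF b] LIMSEQ_unique by blast
    with b show "\<exists>b. b \<longlonglongrightarrow> 0 \<and> (\<forall>t x. \<bar>(T ^^ t) f x - (\<integral>y. f y \<partial>\<pi>)\<bar> \<le> b t)" by blast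
  qed
qed

lemma integral_T_pow_invariant:
  assumes \<pi>: "invariant_measure \<Phi> \<pi>" and f: "finite K" "depends_on K f"
  shows "(\<integral>x. (T ^^ t) f x \<partial>\<pi>) = (\<integral>x. f x \<partial>\<pi>)"
proof (induction t)
  case (Suc t)
  obtain L where L: "finite L" "depends_on L ((T ^^ t) f)"
    using finite_depends_on_T_pow[OF f] by blast
  have "(\<integral>x. (T ^^ t) f x \<partial>(\<pi> \<bind> \<Phi>)) = (\<integral>x. T ((T ^^ t) f) x \<partial>\<pi>)"
    by (rule integral_bind_\<Phi>[OF _ _ L]) (use \<pi> in \<open>auto simp: invariant_measure_def\<close>)
  then show ?case using Suc \<pi> by (simp add: invariant_measure_def)
qed simp

section \<open>Translation invariance and factorisation over distant sites\<close>

lemma T_shift: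
  assumes f: "finite K" "depends_on K f"
  shows "T (\<lambda>x. f (shift k x)) x = T f (shift k x)"
proof -
  have F: "F (shift k x) i = F x (k + i)" for i
    by (simp add: F_eq shift_def add.assoc)
  have meas: "shift k \<in> \<Phi> x \<rightarrow>\<^sub>M borel"
    using measurable_shift sets_\<Phi> by (simp cong: measurable_cong_sets)
  interpret prob_space "\<Phi> x" by (rule prob_space_\<Phi>)
  \<comment> \<open>\<open>F\<close> commutes with shifts and the same noise acts at every site, so
    both measures give each cylinder the same product of transition probabilities.\<close>
  have "distr (\<Phi> x) borel (shift k) = \<Phi> (shift k x)"
  proof (rule prob_measure_eqI_cylinder)
    show "prob_space (distr (\<Phi> x) borel (shift k))" by (rule prob_space_distr[OF meas])
    fix K :: "'d site set" and u :: "('d, 'n) config" assume K: "finite K"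
    have "measure (distr (\<Phi> x) borel (shift k)) (cylinder K u) = measure (\<Phi> x) (shift k -` cylinder K u)"
      by (subst measure_distr[OF meas cylinder_sets[OF K]])
         (simp add: sets_eq_imp_space_eq[OF sets_\<Phi>])
    also have "\<dots> = measure (\<Phi> (shift k x)) (cylinder K u)"
      using K by (simp add: vimage_shift_cylinder measure_\<Phi>_cylinder prod.reindex F)
    finally show "measure (distr (\<Phi> x) borel (shift k)) (cylinder K u) = measure (\<Phi> (shift k x)) (cylinder K u)" .
  qed (simp_all add: prob_space_\<Phi> sets_\<Phi>)
  then show ?thesis
    unfolding T_def by (metis integral_distr[OF meas borel_measurable_depends_on[OF f]])
qed

lemma T_pow_shift:
  assumes f: "finite K" "depends_on K f"
  shows "(T ^^ t) (\<lambda>x. f (shift k x)) = (\<lambda>x. (T ^^ t) f (shift k x))"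
proof (induction t)
  case (Suc t)
  obtain L where L: "finite L" "depends_on L ((T ^^ t) f)"
    using finite_depends_on_T_pow[OF f] by blast
  show ?case
    by (rule ext) (simp only: funpow.simps comp_apply Suc T_shift[OF L])
qed simp

text \<open>Given the present configuration, the new symbols at different sites are
  independent.\<close>

lemma T_mult:
  assumes f: "finite K" "depends_on K f" and g: "finite L" "depends_on L g" and disj: "K \<inter> L = {}"
  shows "T (\<lambda>x. f x * g x) x = T f x * T g x"
  unfolding T_def
proof (rule integral_mult_depends_on[OF f g prob_space_\<Phi> sets_\<Phi>])
  fix u w :: "('d, 'n) config"
  define z where "z = (\<lambda>k. if k \<in> K then u k else w k)"
  have "cylinder K u \<inter> cylinder L w = cylinder (K \<union> L) z"
    using disj by (auto simp: cylinder_def z_def)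
  moreover have "(\<Prod>k\<in>K. birth_death_noise \<beta> \<delta> (F x k) (z k)) = (\<Prod>k\<in>K. birth_death_noise \<beta> \<delta> (F x k) (u k))"
    by (rule prod.cong) (auto simp: z_def)
  moreover have "(\<Prod>k\<in>L. birth_death_noise \<beta> \<delta> (F x k) (z k)) = (\<Prod>k\<in>L. birth_death_noise \<beta> \<delta> (F x k) (w k))"
    by (rule prod.cong) (use disj in \<open>auto simp: z_def\<close>)
  ultimately show "measure (\<Phi> x) (cylinder K u \<inter> cylinder L w)
      = measure (\<Phi> x) (cylinder K u) * measure (\<Phi> x) (cylinder L w)"
    using f g by (simp add: measure_\<Phi>_cylinder prod.union_disjoint[OF f(1) g(1) disj])
qed

text \<open>Each application of \<open>T\<close> enlarges the two cubes of dependence by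
  \<open>radius\<close>. If they are disjoint after \<open>t\<close> steps, they were disjoint at
  all earlier steps, so \<open>T_mult\<close> applies each time.\<close>

lemma T_pow_mult:
  assumes f: "depends_on (cube c R) f" and g: "depends_on (cube e R) g"
    and disj: "cube c (R + t * radius) \<inter> cube e (R + t * radius) = {}"
  shows "(T ^^ t) (\<lambda>x. f x * g x) = (\<lambda>x. (T ^^ t) f x * (T ^^ t) g x)"
  using disj
proof (induction t)
  case (Suc t)
  have "cube m (R + t * radius) \<subseteq> cube m (R + Suc t * radius)" for m :: "'d site"
    by (auto simp: cube_def algebra_simps intro: order_trans)
  then have disj: "cube c (R + t * radius) \<inter> cube e (R + t * radius) = {}"
    using Suc.prems by blast
  note mult = T_mult[OF finite_cube depends_on_T_pow[OF f] finite_cube depends_on_T_pow[OF g] disj]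
  show ?case
    by (rule ext) (simp only: funpow.simps comp_apply Suc.IH[OF disj] mult)
qed simp

text \<open>Invariance: the iterates of \<open>T f\<close> are those of \<open>f\<close> advanced by
  one step, so both have the same limit. Uniqueness: integrating \<open>(T ^^ t) f\<close> against
  an invariant \<open>\<pi>'\<close> returns the \<open>\<pi>'\<close>-integral of \<open>f\<close>,
  while the integrand tends uniformly to the \<open>\<pi>\<close>-integral.\<close>

lemma
  assumes "ergodic_limit \<pi>"
  shows invariant_measure_ergodic_limit: "invariant_measure \<Phi> \<pi>"
    and invariant_measure_unique: "invariant_measure \<Phi> \<pi>' \<Longrightarrow> \<pi>' = \<pi>"
proof -
  note \<pi> = ergodic_limitD(1,2)[OF assms] and lim = ergodic_limitD(3)[OF assms]
  fix x0 :: "('d, 'n) config"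
  have tends: "(\<lambda>t. (T ^^ t) f x0) \<longlonglongrightarrow> (\<integral>y. f y \<partial>\<pi>)" if f: "finite K" "depends_on K f" for K f
  proof -
    obtain b where b: "b \<longlonglongrightarrow> 0" "\<forall>t x. \<bar>(T ^^ t) f x - (\<integral>y. f y \<partial>\<pi>)\<bar> \<le> b t"
      using lim[OF f] by blast
    have "(\<lambda>t. (T ^^ t) f x0 - (\<integral>y. f y \<partial>\<pi>)) \<longlonglongrightarrow> 0"
      by (rule Lim_null_comparison[OF _ b(1)]) (use b(2) in auto)
    then show ?thesis by (simp add: LIM_zero_iff)
  qed
  have T_inv: "(\<integral>y. T f y \<partial>\<pi>) = (\<integral>y. f y \<partial>\<pi>)" if f: "finite K" "depends_on K f" for K f
  proof -
    obtain L where L: "finite L" "depends_on L (T f)"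
      using finite_depends_on_T_pow[OF f, of 1] by auto
    have "(\<lambda>t. (T ^^ Suc t) f x0) \<longlonglongrightarrow> (\<integral>y. f y \<partial>\<pi>)"
      using LIMSEQ_Suc[OF tends[OF f]] .
    then show ?thesis
      using LIMSEQ_unique[OF tends[OF L]] by (simp add: funpow_swap1)
  qed
  have measure_eq: "measure M (cylinder K u) = (\<integral>y. indicator (cylinder K u) y \<partial>M)"
    if "sets M = sets borel" for M :: "('d, 'n) config measure" and K u
    using sets_eq_imp_space_eq[OF that] by simp
  have "\<pi> \<bind> \<Phi> = \<pi>"
  proof (rule prob_measure_eqI_cylinder[OF prob_space_bind_\<Phi>[OF \<pi>] sets_bind_\<Phi>[OF \<pi>] \<pi>])
    fix K :: "'d site set" and u :: "('d, 'n) config" assume K: "finite K"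
    show "measure (\<pi> \<bind> \<Phi>) (cylinder K u) = measure \<pi> (cylinder K u)"
      unfolding measure_eq[OF \<pi>(2)] measure_eq[OF sets_bind_\<Phi>[OF \<pi>]]
        integral_bind_\<Phi>[OF \<pi> K depends_on_indicator_cylinder]
      by (rule T_inv[OF K depends_on_indicator_cylinder])
  qed
  with \<pi> show "invariant_measure \<Phi> \<pi>" by (simp add: invariant_measure_def)
  assume inv: "invariant_measure \<Phi> \<pi>'"
  then have \<pi>': "prob_space \<pi>'" "sets \<pi>' = sets borel" by (simp_all add: invariant_measure_def)
  interpret \<pi>': prob_space \<pi>' by fact
  show "\<pi>' = \<pi>"
  proof (rule prob_measure_eqI_cylinder[OF \<pi>' \<pi>])
    fix K :: "'d site set" and u :: "('d, 'n) config" assume K: "finite K"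
    define f where "f = (indicator (cylinder K u) :: _ \<Rightarrow> real)"
    have f: "finite K" "depends_on K f" using K by (simp_all add: f_def depends_on_indicator_cylinder)
    obtain b where b: "b \<longlonglongrightarrow> 0" "\<And>t x. \<bar>(T ^^ t) f x - (\<integral>y. f y \<partial>\<pi>)\<bar> \<le> b t"
      using lim[OF f] by blast
    have "\<bar>(\<integral>y. f y \<partial>\<pi>') - (\<integral>y. f y \<partial>\<pi>)\<bar> \<le> b t" for t
    proof -
      obtain L where L: "finite L" "depends_on L ((T ^^ t) f)"
        using finite_depends_on_T_pow[OF f] by blast
      show ?thesis
        using \<pi>'.integral_near_const[OF integrable_depends_on[OF L \<pi>'] b(2)]
        by (simp add: integral_T_pow_invariant[OF inv f])
    qed
    then have "\<bar>(\<integral>y. f y \<partial>\<pi>') - (\<integral>y. f y \<partial>\<pi>)\<bar> \<le> 0"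
      by (intro LIMSEQ_le_const[OF b(1)]) auto
    then show "measure \<pi>' (cylinder K u) = measure \<pi> (cylinder K u)"
      unfolding measure_eq[OF \<pi>(2)] measure_eq[OF \<pi>'(2)] f_def by simp
  qed
qed

text \<open>The time \<open>t\<close> is fixed first, according to the required precision. For
  distant \<open>k\<close> the \<open>t\<close>-th iterate of the product then factorises exactly,
  and both factors are uniformly close to constants; invariance carries this estimate over to the
  integral of the product itself.\<close>

lemma spatially_mixing_ergodic_limit:
  assumes "ergodic_limit \<pi>"
  shows "spatially_mixing \<pi>"
  unfolding spatially_mixing_def
proof (intro allI impI)
  note \<pi> = ergodic_limitD(1,2)[OF assms] and lim = ergodic_limitD(3)[OF assms]
  fix K L :: "'d site set" and u v' :: "('d, 'n) config"
  assume K: "finite K" and L: "finite L"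
  interpret prob_space \<pi> by fact
  have inv: "invariant_measure \<Phi> \<pi>" by (rule invariant_measure_ergodic_limit[OF assms])
  obtain R where R: "K \<union> L \<subseteq> cube 0 R" using finite_subset_cube[of "K \<union> L"] K L by blast
  define f g where "f = (indicator (cylinder K u) :: _ \<Rightarrow> real)"
    and "g = (indicator (cylinder L v') :: _ \<Rightarrow> real)"
  have f: "depends_on (cube 0 R) f" and g: "depends_on (cube 0 R) g"
    unfolding f_def g_def using R by (auto intro: depends_on_mono[OF depends_on_indicator_cylinder])
  have int_f: "(\<integral>y. f y \<partial>\<pi>) = measure \<pi> (cylinder K u)" and int_g: "(\<integral>y. g y \<partial>\<pi>) = measure \<pi> (cylinder L v')"
    using sets_eq_imp_space_eq[OF \<pi>(2)] by (simp_all add: f_def g_def)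
  let ?a = "measure \<pi> (cylinder K u)" and ?c = "measure \<pi> (cylinder L v')"
  obtain b where b: "b \<longlonglongrightarrow> 0" "\<And>t x. \<bar>(T ^^ t) f x - ?a\<bar> \<le> b t"
    using lim[OF finite_cube f] unfolding int_f by blast
  obtain b' where b': "b' \<longlonglongrightarrow> 0" "\<And>t x. \<bar>(T ^^ t) g x - ?c\<bar> \<le> b' t"
    using lim[OF finite_cube g] unfolding int_g by blast
  \<comment> \<open>The error comes from \<open>(?p - ?a) * ?q + ?a * (?q - ?c)\<close>, where
    \<open>?q\<close> is at most \<open>1 + b' t\<close> in absolute value and \<open>?a\<close> is
    at most 1.\<close>
  have "(\<lambda>t. b t * (1 + b' t) + b' t) \<longlonglongrightarrow> 0 * (1 + 0) + 0"
    by (intro tendsto_intros b b')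
  then have B: "(\<lambda>t. b t * (1 + b' t) + b' t) \<longlonglongrightarrow> 0" by simp
  show "((\<lambda>k. measure \<pi> (cylinder K u \<inter> shift k -` cylinder L v')) \<longlongrightarrow> ?a * ?c) cofinite"
  proof (rule tendstoI)
    fix \<epsilon> :: real assume "0 < \<epsilon>"
    then have "\<forall>\<^sub>F t in sequentially. b t * (1 + b' t) + b' t < \<epsilon>"
      by (rule order_tendstoD(2)[OF B])
    then obtain t where t: "b t * (1 + b' t) + b' t < \<epsilon>"
      unfolding eventually_sequentially by blast
    \<comment> \<open>Outside this cube of doubled radius, the cubes of radius
      \<open>R + t * radius\<close> around 0 and \<open>k\<close> are disjoint. Only finitely many
      \<open>k\<close> are excluded, as convergence along cofinite sets requires.\<close>
    have "dist (measure \<pi> (cylinder K u \<inter> shift k -` cylinder L v')) (?a * ?c) < \<epsilon>"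
      if k: "k \<notin> cube 0 (2 * (R + t * radius))" for k
    proof -
      define gk where "gk = (\<lambda>x. g (shift k x))"
      have gk: "depends_on (cube k R) gk"
        unfolding gk_def using depends_on_shift[OF g, of k] by simp
      have fg: "finite (cube 0 R \<union> cube k R)" "depends_on (cube 0 R \<union> cube k R) (\<lambda>x. f x * gk x)"
        using depends_on_mult[OF f gk] by (simp_all add: finite_cube)
      obtain M where M: "finite M" "depends_on M ((T ^^ t) (\<lambda>x. f x * gk x))"
        using finite_depends_on_T_pow[OF fg] by blast
      have near: "\<bar>(T ^^ t) (\<lambda>x. f x * gk x) x - ?a * ?c\<bar> \<le> b t * (1 + b' t) + b' t" for x
      proof -
        let ?p = "(T ^^ t) f x" and ?q = "(T ^^ t) g (shift k x)"
        have "(T ^^ t) gk x = ?q"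
          unfolding gk_def T_pow_shift[OF finite_cube g] ..
        then have "(T ^^ t) (\<lambda>x. f x * gk x) x = ?p * ?q"
          unfolding T_pow_mult[OF f gk cube_disjoint[OF k]] by simp
        moreover have "?p * ?q - ?a * ?c = (?p - ?a) * ?q + ?a * (?q - ?c)"
          by (simp add: algebra_simps)
        moreover have "\<bar>(?p - ?a) * ?q\<bar> \<le> b t * (1 + b' t)"
          unfolding abs_mult
        proof (rule mult_mono)
          show "\<bar>?q\<bar> \<le> 1 + b' t"
            using b'(2)[of t "shift k x"] prob_le_1[of "cylinder L v'"] measure_nonneg[of \<pi> "cylinder L v'"]
            by linarith
          show "0 \<le> b t" using b(2)[of t x] by linarith
        qed (use b(2) in auto)
        moreover have "\<bar>?a * (?q - ?c)\<bar> \<le> 1 * b' t"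
          unfolding abs_mult by (rule mult_mono) (use b'(2) in auto)
        ultimately show ?thesis by linarith
      qed
      have "\<bar>(\<integral>x. f x * gk x \<partial>\<pi>) - ?a * ?c\<bar> \<le> b t * (1 + b' t) + b' t"
        using integral_near_const[OF integrable_depends_on[OF M \<pi>] near]
        by (simp add: integral_T_pow_invariant[OF inv fg])
      moreover have "(\<integral>x. f x * gk x \<partial>\<pi>) = measure \<pi> (cylinder K u \<inter> shift k -` cylinder L v')"
      proof -
        have "(\<lambda>x. f x * gk x) = indicator (cylinder K u \<inter> shift k -` cylinder L v')"
          by (auto simp: f_def g_def gk_def indicator_def fun_eq_iff)
        then show ?thesis using sets_eq_imp_space_eq[OF \<pi>(2)] by simp
      qed
      ultimately show ?thesis using t by (simp add: dist_real_def)
    qed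
    then have "{k. \<not> dist (measure \<pi> (cylinder K u \<inter> shift k -` cylinder L v')) (?a * ?c) < \<epsilon>}
        \<subseteq> cube 0 (2 * (R + t * radius))"
      by blast
    then show "\<forall>\<^sub>F k in cofinite. dist (measure \<pi> (cylinder K u \<inter> shift k -` cylinder L v')) (?a * ?c) < \<epsilon>"
      unfolding eventually_cofinite by (rule finite_subset[OF _ finite_cube])
  qed
qed

lemma uniformly_ergodic_spatially_mixing:
  "uniformly_ergodic \<Phi> \<and> (\<exists>\<pi>. invariant_measure \<Phi> \<pi> \<and> spatially_mixing \<pi>)"
proof -
  obtain \<pi> where lim: "ergodic_limit \<pi>"
    using ergodic_limit_exists by blast
  have "uniform_limit UNIV (\<lambda>t x. measure (kernel_power \<Phi> t x) (cylinder K u))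
      (\<lambda>x. measure \<pi> (cylinder K u)) sequentially" if K: "finite K" for K u
  proof (rule uniform_limitI)
    fix e :: real assume e: "0 < e"
    obtain b where b: "b \<longlonglongrightarrow> 0"
      and "\<And>t x. \<bar>(T ^^ t) (indicator (cylinder K u)) x - (\<integral>y. indicator (cylinder K u) y \<partial>\<pi>)\<bar> \<le> b t"
      using ergodic_limitD(3)[OF lim K depends_on_indicator_cylinder] by blast
    then have close: "\<bar>measure (kernel_power \<Phi> t x) (cylinder K u) - measure \<pi> (cylinder K u)\<bar> \<le> b t" for t x
      unfolding integral_kernel_power[OF K depends_on_indicator_cylinder, symmetric]
      using sets_eq_imp_space_eq[OF kernel_power_prob(2)] sets_eq_imp_space_eq[OF ergodic_limitD(2)[OF lim]] by simp
    have "\<forall>\<^sub>F t in sequentially. b t < e" using order_tendstoD(2)[OF b e] .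
    then show "\<forall>\<^sub>F t in sequentially. \<forall>x\<in>UNIV.
        dist (measure (kernel_power \<Phi> t x) (cylinder K u)) (measure \<pi> (cylinder K u)) < e"
      by (rule eventually_mono) (simp add: dist_real_def le_less_trans[OF close])
  qed
  then have "uniformly_ergodic \<Phi>"
    unfolding uniformly_ergodic_def
    by (intro exI[of _ \<pi>] conjI allI impI invariant_measure_ergodic_limit[OF lim] invariant_measure_unique[OF lim])
  then show ?thesis
    using invariant_measure_ergodic_limit[OF lim] spatially_mixing_ergodic_limit[OF lim] by blast
qed

end

theorem theorem3p12:
  fixes F :: "('d::finite, 'n::finite) config \<Rightarrow> ('d, 'n) config"
    and \<theta> :: "'n symbol \<Rightarrow> 'n symbol \<Rightarrow> real"
  assumes "gliders_with_annihilation F"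
    and "positive_birth_death_noise \<theta>"
  shows "uniformly_ergodic (noisy_version F \<theta>) \<and>
         (\<exists>\<pi>. invariant_measure (noisy_version F \<theta>) \<pi> \<and> spatially_mixing \<pi>)"
proof -
  obtain h v where h: "annihilation_rule h" and F: "F = (\<lambda>x k. h (\<lambda>i. x (k + v i) i))"
    using assms(1) unfolding gliders_with_annihilation_def annihilation_CA_def gliders_CA_def
      gliders_def by (auto simp: o_def)
  obtain \<beta> \<delta> where bd: "\<forall>i. \<beta> i \<in> {0<..<1} \<and> \<delta> i \<in> {0<..<1}" and \<theta>: "\<theta> = birth_death_noise \<beta> \<delta>"
    using assms(2) unfolding positive_birth_death_noise_def by blast
  \<comment> \<open>The definite description satisfies \<open>is_noisy_version\<close> because
    exactly one such kernel exists.\<close>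
  interpret noisy_gliders F v h \<beta> \<delta> "noisy_version F \<theta>"
    using h bd is_noisy_version_noisy_version[OF assms] by unfold_locales (auto simp: F \<theta>)
  show ?thesis by (rule uniformly_ergodic_spatially_mixing)
qed

end
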